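(* The satisfiability problem for $\mathrm{F}_1[\mathrm{succ}_1,\mathrm{succ}_2]$ is undecidable, where structures consist of a finite domain with unary predicates and two linear orders, accessed only through their respective successor relations $\mathrm{succ}_1$ and $\mathrm{succ}_2$.
   Context: $\mathrm{F}_1$ (one-dimensional fragment) is the smallest set of first-order formulas containing atoms and equalities, closed under $\vee,\neg$, and such that if $\varphi$ has free variables among $x_0,\dots,x_k$ then $\exists x_0\dots x_k\varphi$ and $\exists x_1\dots x_k\varphi$ are in it. In $\mathrm{F}_1[\mathrm{succ}_1,\mathrm{succ}_2]$ the signature consists of finitely many unary symbols and two binary symbols $\mathrm{succ}_1,\mathrm{succ}_2$, required to be interpreted as the successor relations of two (independent) strict linear orders on the domain. *)

theory Defs
  imports Main "HOL-Library.Nat_Bijection"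
begin

section \<open>First-order formulas over unary symbols and two successor relations\<close>

text \<open>
  Variables and unary relation symbols are natural numbers. A formula mentions only finitely many
  unary symbols; which ones is part of the formula, so the whole countable supply is available.
\<close>

datatype fo =
    Pred nat nat       \<comment> \<open>\<open>Pred p x\<close> is the atom \<open>p(x)\<close>\<close>
  | Succ1 nat nat
  | Succ2 nat nat
  | Equal nat nat
  | Neg fo
  | Or fo fo
  | Exists nat fo

primrec fv :: "fo \<Rightarrow> nat set" where
  "fv (Pred p x) = {x}"
| "fv (Succ1 x y) = {x, y}"
| "fv (Succ2 x y) = {x, y}"
| "fv (Equal x y) = {x, y}"
| "fv (Neg \<phi>) = fv \<phi>"
| "fv (Or \<phi> \<psi>) = fv \<phi> \<union> fv \<psi>"
| "fv (Exists x \<phi>) = fv \<phi> - {x}"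

definition Exists_block :: "nat list \<Rightarrow> fo \<Rightarrow> fo" where
  "Exists_block xs \<phi> = foldr Exists xs \<phi>"

text \<open>
  The one-dimensional fragment. In the last two rules \<open>x0 # xs\<close> is the list of (arbitrary, pairwise
  distinct) variables \<open>x\<^sub>0, \<dots>, x\<^sub>k\<close>. The proper subformulas \<open>\<exists>x\<^sub>i\<dots>x\<^sub>k \<phi>\<close> of a block need not
  belong to the fragment themselves.
\<close>

inductive_set F1 :: "fo set" where
  Pred: "Pred p x \<in> F1"
| Succ1: "Succ1 x y \<in> F1"
| Succ2: "Succ2 x y \<in> F1"
| Equal: "Equal x y \<in> F1"
| Neg: "\<phi> \<in> F1 \<Longrightarrow> Neg \<phi> \<in> F1"
| Or: "\<lbrakk>\<phi> \<in> F1; \<psi> \<in> F1\<rbrakk> \<Longrightarrow> Or \<phi> \<psi> \<in> F1"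
| Exists_all: "\<lbrakk>\<phi> \<in> F1; distinct (x0 # xs); fv \<phi> \<subseteq> set (x0 # xs)\<rbrakk> \<Longrightarrow> Exists_block (x0 # xs) \<phi> \<in> F1"
| Exists_all_but_one: "\<lbrakk>\<phi> \<in> F1; distinct (x0 # xs); fv \<phi> \<subseteq> set (x0 # xs)\<rbrakk> \<Longrightarrow> Exists_block xs \<phi> \<in> F1"

definition F1_sentences :: "fo set" where
  "F1_sentences = {\<phi> \<in> F1. fv \<phi> = {}}"

section \<open>Structures and satisfaction\<close>

record 'a struct =
  carrier :: "'a set"
  unary :: "nat \<Rightarrow> 'a set"
  succ1 :: "'a rel"
  succ2 :: "'a rel"

definition successor_rel :: "'a rel \<Rightarrow> 'a rel" where
  "successor_rel r = {(a, b). (a, b) \<in> r \<and> \<not> (\<exists>c. (a, c) \<in> r \<and> (c, b) \<in> r)}"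

text \<open>
  The inclusion \<open>r \<subseteq> A \<times> A\<close> is needed because \<^const>\<open>strict_linear_order_on\<close> by itself does not
  confine the relation to its carrier.
\<close>

definition is_successor_on :: "'a set \<Rightarrow> 'a rel \<Rightarrow> bool" where
  "is_successor_on A s \<longleftrightarrow>
     (\<exists>r. r \<subseteq> A \<times> A \<and> strict_linear_order_on A r \<and> s = successor_rel r)"

definition finite_structure :: "'a struct \<Rightarrow> bool" where
  "finite_structure M \<longleftrightarrow>
     finite (carrier M) \<and> carrier M \<noteq> {} \<and> (\<forall>p. unary M p \<subseteq> carrier M) \<and>
     is_successor_on (carrier M) (succ1 M) \<and> is_successor_on (carrier M) (succ2 M)"

primrec sat :: "'a struct \<Rightarrow> (nat \<Rightarrow> 'a) \<Rightarrow> fo \<Rightarrow> bool" where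
  "sat M \<sigma> (Pred p x) \<longleftrightarrow> \<sigma> x \<in> unary M p"
| "sat M \<sigma> (Succ1 x y) \<longleftrightarrow> (\<sigma> x, \<sigma> y) \<in> succ1 M"
| "sat M \<sigma> (Succ2 x y) \<longleftrightarrow> (\<sigma> x, \<sigma> y) \<in> succ2 M"
| "sat M \<sigma> (Equal x y) \<longleftrightarrow> \<sigma> x = \<sigma> y"
| "sat M \<sigma> (Neg \<phi>) \<longleftrightarrow> \<not> sat M \<sigma> \<phi>"
| "sat M \<sigma> (Or \<phi> \<psi>) \<longleftrightarrow> sat M \<sigma> \<phi> \<or> sat M \<sigma> \<psi>"
| "sat M \<sigma> (Exists x \<phi>) \<longleftrightarrow> (\<exists>a \<in> carrier M. sat M (\<sigma>(x := a)) \<phi>)"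

text \<open>
  Domains are finite sets of natural numbers. This loses no generality: see \<open>satisfiableI\<close> below,
  which covers structures over an arbitrary type.
\<close>

definition satisfiable :: "fo \<Rightarrow> bool" where
  "satisfiable \<phi> \<longleftrightarrow>
     (\<exists>(M :: nat struct) \<sigma>. finite_structure M \<and> range \<sigma> \<subseteq> carrier M \<and> sat M \<sigma> \<phi>)"

definition map_struct :: "('a \<Rightarrow> 'b) \<Rightarrow> 'a struct \<Rightarrow> 'b struct" where
  "map_struct h M =
     \<lparr>carrier = h ` carrier M, unary = (\<lambda>p. h ` unary M p),
      succ1 = map_prod h h ` succ1 M, succ2 = map_prod h h ` succ2 M\<rparr>"

lemma successor_rel_iff:
  "(a, b) \<in> successor_rel r \<longleftrightarrow> (a, b) \<in> r \<and> \<not> (\<exists>c. (a, c) \<in> r \<and> (c, b) \<in> r)"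
  by (simp add: successor_rel_def)

lemma is_successor_on_subset: "is_successor_on A s \<Longrightarrow> s \<subseteq> A \<times> A"
  by (auto simp: is_successor_on_def successor_rel_def)

lemma map_prod_image_iff:
  assumes "inj_on h A" "r \<subseteq> A \<times> A" "a \<in> A" "b \<in> A"
  shows "(h a, h b) \<in> map_prod h h ` r \<longleftrightarrow> (a, b) \<in> r"
proof
  assume "(h a, h b) \<in> map_prod h h ` r"
  then obtain q where q: "q \<in> r" "(h a, h b) = map_prod h h q"
    by (elim imageE)
  obtain a' b' where [simp]: "q = (a', b')" by (cases q)
  have "a' \<in> A" "b' \<in> A" using subsetD[OF assms(2) q(1)] by simp_all
  then have "a' = a" "b' = b"
    using q(2) inj_on_eq_iff[OF assms(1)] assms(3,4) by auto
  then show "(a, b) \<in> r" using q(1) by simp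
qed (rule map_prod_imageI)

lemma is_successor_on_image:
  assumes h: "inj_on h A" and s: "is_successor_on A s"
  shows "is_successor_on (h ` A) (map_prod h h ` s)"
proof -
  obtain r where r: "r \<subseteq> A \<times> A" "strict_linear_order_on A r" "s = successor_rel r"
    using s by (auto simp: is_successor_on_def)
  let ?r = "map_prod h h ` r"
  have sub: "?r \<subseteq> h ` A \<times> h ` A"
    using r(1) by auto
  have iff: "(h a, h b) \<in> ?r \<longleftrightarrow> (a, b) \<in> r" if "a \<in> A" "b \<in> A" for a b
    using map_prod_image_iff[OF h r(1) that] .
  have "trans ?r"
  proof (rule transI)
    fix x y z assume xy: "(x, y) \<in> ?r" and yz: "(y, z) \<in> ?r"
    have "x \<in> h ` A" "y \<in> h ` A" "z \<in> h ` A"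
      using subsetD[OF sub xy] subsetD[OF sub yz] by simp_all
    then obtain a b c where "a \<in> A" "b \<in> A" "c \<in> A" "x = h a" "y = h b" "z = h c"
      by (elim imageE)
    then show "(x, z) \<in> ?r"
      using xy yz iff r(2) unfolding strict_linear_order_on_def by (metis transD)
  qed
  moreover have "irrefl ?r"
  proof (rule irreflI)
    fix x show "(x, x) \<notin> ?r"
    proof
      assume x: "(x, x) \<in> ?r"
      then have "x \<in> h ` A"
        using subsetD[OF sub x] by simp
      then show False
        using x iff r(2) unfolding strict_linear_order_on_def irrefl_def by (metis imageE)
    qed
  qed
  moreover have "total_on (h ` A) ?r"
    using iff r(2) unfolding strict_linear_order_on_def total_on_def by (metis imageE)
  moreover have "map_prod h h ` s = successor_rel ?r"
  proof (rule set_eqI)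
    fix p :: "'b \<times> 'b"
    obtain x y where p: "p = (x, y)" by (cases p)
    have s_sub: "s \<subseteq> A \<times> A"
      using s by (rule is_successor_on_subset)
    show "p \<in> map_prod h h ` s \<longleftrightarrow> p \<in> successor_rel ?r"
    proof (cases "x \<in> h ` A \<and> y \<in> h ` A")
      case True
      then obtain a b where ab: "a \<in> A" "b \<in> A" "x = h a" "y = h b" by blast
      have "(\<exists>z. (x, z) \<in> ?r \<and> (z, y) \<in> ?r) \<longleftrightarrow> (\<exists>c. (a, c) \<in> r \<and> (c, b) \<in> r)"
      proof
        assume "\<exists>z. (x, z) \<in> ?r \<and> (z, y) \<in> ?r"
        then obtain z where z: "(x, z) \<in> ?r" "(z, y) \<in> ?r" by (elim exE conjE)
        have "z \<in> h ` A" using subsetD[OF sub z(1)] by simp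
        then obtain c where "c \<in> A" "z = h c" by (elim imageE)
        then show "\<exists>c. (a, c) \<in> r \<and> (c, b) \<in> r"
          using z ab iff by metis
      next
        assume "\<exists>c. (a, c) \<in> r \<and> (c, b) \<in> r"
        then obtain c where c: "(a, c) \<in> r" "(c, b) \<in> r" by (elim exE conjE)
        have "c \<in> A" using subsetD[OF r(1) c(1)] by simp
        then show "\<exists>z. (x, z) \<in> ?r \<and> (z, y) \<in> ?r"
          using c ab iff by metis
      qed
      then show ?thesis
        using map_prod_image_iff[OF h s_sub ab(1,2)] iff[OF ab(1,2)]
        unfolding p ab(3,4) r(3) successor_rel_iff by metis
    next
      case False
      have "p \<notin> map_prod h h ` s"
        using False s_sub unfolding p by auto
      moreover have "(x, y) \<notin> ?r"
        using False subsetD[OF sub, of "(x, y)"] by blast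
      ultimately show ?thesis
        unfolding p successor_rel_iff by metis
    qed
  qed
  ultimately show ?thesis
    using sub unfolding is_successor_on_def strict_linear_order_on_def
    by (intro exI[of _ ?r] conjI)
qed

lemma finite_structure_map_struct:
  assumes "inj_on h (carrier M)" "finite_structure M"
  shows "finite_structure (map_struct h M)"
  using assms(2) is_successor_on_image[OF assms(1)]
  unfolding finite_structure_def map_struct_def by (simp add: image_mono)

lemma sat_map_struct:
  assumes h: "inj_on h (carrier M)" and M: "finite_structure M" and "range \<sigma> \<subseteq> carrier M"
  shows "sat (map_struct h M) (h \<circ> \<sigma>) \<phi> \<longleftrightarrow> sat M \<sigma> \<phi>"
  using assms(3)
proof (induction \<phi> arbitrary: \<sigma>)
  case (Pred p x)
  have "\<sigma> x \<in> carrier M" "unary M p \<subseteq> carrier M"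
    using Pred M by (auto simp: finite_structure_def)
  then show ?case
    using h by (auto simp: map_struct_def dest: inj_onD)
next
  case (Succ1 x y)
  then show ?case
    using map_prod_image_iff[OF h] M
    by (simp add: map_struct_def finite_structure_def is_successor_on_subset range_subsetD)
next
  case (Succ2 x y)
  then show ?case
    using map_prod_image_iff[OF h] M
    by (simp add: map_struct_def finite_structure_def is_successor_on_subset range_subsetD)
next
  case (Equal x y)
  then show ?case
    using inj_on_eq_iff[OF h] by (simp add: range_subsetD)
next
  case (Exists x \<phi>)
  have "sat (map_struct h M) ((h \<circ> \<sigma>)(x := h a)) \<phi> \<longleftrightarrow> sat M (\<sigma>(x := a)) \<phi>" if "a \<in> carrier M" for a
  proof -
    have "(h \<circ> \<sigma>)(x := h a) = h \<circ> \<sigma>(x := a)" by auto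
    moreover have "range (\<sigma>(x := a)) \<subseteq> carrier M" using Exists.prems that by auto
    ultimately show ?thesis using Exists.IH by metis
  qed
  moreover have "carrier (map_struct h M) = h ` carrier M"
    by (simp add: map_struct_def)
  ultimately show ?case
    unfolding sat.simps bex_simps(7) by (metis (no_types, lifting) imageE imageI)
qed simp_all

lemma satisfiableI:
  fixes M :: "'a struct"
  assumes M: "finite_structure M" and \<sigma>: "range \<sigma> \<subseteq> carrier M" and "sat M \<sigma> \<phi>"
  shows "satisfiable \<phi>"
proof -
  obtain h :: "'a \<Rightarrow> nat" where h: "inj_on h (carrier M)"
    using M finite_imp_inj_to_nat_seg unfolding finite_structure_def by metis
  have "range (h \<circ> \<sigma>) \<subseteq> carrier (map_struct h M)"
    using \<sigma> by (auto simp: map_struct_def)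
  then show ?thesis
    using finite_structure_map_struct[OF h M] sat_map_struct[OF h M \<sigma>] assms(3)
    unfolding satisfiable_def by blast
qed

section \<open>Partial recursive functions and decidability\<close>

text \<open>
  Kleene's partial recursive functions, as terms with a graph \<open>rec_eval f xs y\<close> (``\<open>f\<close> is defined on
  the argument list \<open>xs\<close> with value \<open>y\<close>''). Arities are implicit: a term is simply undefined on
  argument lists of an unsuitable length.
\<close>

datatype recf =
    RZero
  | RSuc
  | RProj nat
  | RComp recf "recf list"
  | RPrim recf recf
  | RMu recf

inductive rec_eval :: "recf \<Rightarrow> nat list \<Rightarrow> nat \<Rightarrow> bool" where
  zero: "rec_eval RZero xs 0"
| suc: "rec_eval RSuc [x] (Suc x)"
| proj: "i < length xs \<Longrightarrow> rec_eval (RProj i) xs (xs ! i)"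
| comp: "\<lbrakk>length ys = length gs; \<forall>i < length gs. rec_eval (gs ! i) xs (ys ! i); rec_eval f ys z\<rbrakk>
    \<Longrightarrow> rec_eval (RComp f gs) xs z"
| prim_0: "rec_eval f xs y \<Longrightarrow> rec_eval (RPrim f g) (0 # xs) y"
| prim_Suc: "\<lbrakk>rec_eval (RPrim f g) (n # xs) y; rec_eval g (n # y # xs) z\<rbrakk>
    \<Longrightarrow> rec_eval (RPrim f g) (Suc n # xs) z"
| mu: "\<lbrakk>rec_eval f (n # xs) 0; \<forall>m < n. \<exists>y. rec_eval f (m # xs) (Suc y)\<rbrakk>
    \<Longrightarrow> rec_eval (RMu f) xs n"

inductive_cases rec_eval_elims:
  "rec_eval RZero xs y"
  "rec_eval RSuc xs y"
  "rec_eval (RProj i) xs y"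
  "rec_eval (RComp f gs) xs y"
  "rec_eval (RPrim f g) (0 # xs) y"
  "rec_eval (RPrim f g) (Suc n # xs) y"
  "rec_eval (RMu f) xs y"

lemma rec_eval_functional: "rec_eval f xs y \<Longrightarrow> rec_eval f xs z \<Longrightarrow> y = z"
proof (induction arbitrary: z rule: rec_eval.induct)
  case (zero xs)
  then show ?case by (elim rec_eval_elims) simp
next
  case (suc x)
  then show ?case by (elim rec_eval_elims) simp
next
  case (proj i xs)
  from proj.prems show ?case by (elim rec_eval_elims) simp
next
  case (comp ys gs xs f w)
  from comp.prems obtain ys' where ys':
    "length ys' = length gs" "\<forall>i < length gs. rec_eval (gs ! i) xs (ys' ! i)" "rec_eval f ys' z"
    by (elim rec_eval_elims)
  have "ys = ys'"
    by (rule nth_equalityI) (use comp.hyps comp.IH(1) ys'(1,2) in metis)+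
  then show ?case
    using comp.IH(2) ys'(3) by metis
next
  case (prim_0 f xs y g)
  from prim_0.prems have "rec_eval f xs z" by (elim rec_eval_elims)
  then show ?case by (rule prim_0.IH)
next
  case (prim_Suc f g n xs y w)
  from prim_Suc.prems obtain y' where "rec_eval (RPrim f g) (n # xs) y'" "rec_eval g (n # y' # xs) z"
    by (elim rec_eval_elims)
  then show ?case
    using prim_Suc.IH by metis
next
  case (mu f n xs)
  from mu.prems have z: "rec_eval f (z # xs) 0" "\<forall>m < z. \<exists>y. rec_eval f (m # xs) (Suc y)"
    by (auto elim: rec_eval_elims(7))
  have "\<not> z < n"
    using mu.IH(2) z(1) by (metis nat.distinct(1))
  moreover have "\<not> n < z"
    using mu.IH(1) z(2) by (metis nat.distinct(1))
  ultimately show ?case by simp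
qed

text \<open>
  A decision problem consists of instances \<open>I\<close>, coded as natural numbers by \<open>c\<close>, and a yes/no
  question \<open>P\<close>. A decision procedure must halt with the right answer on every instance; its behaviour
  on numbers that code no instance is irrelevant. Undecidability in this sense implies that the set
  \<open>c ` {x \<in> I. P x}\<close> of (codes of) yes-instances is not recursive.
\<close>

definition decidable_problem :: "('i \<Rightarrow> nat) \<Rightarrow> 'i set \<Rightarrow> ('i \<Rightarrow> bool) \<Rightarrow> bool" where
  "decidable_problem c I P \<longleftrightarrow> (\<exists>f. \<forall>x \<in> I. rec_eval f [c x] (if P x then 1 else 0))"

primrec fo_code :: "fo \<Rightarrow> nat" where
  "fo_code (Pred p x) = prod_encode (0, prod_encode (p, x))"
| "fo_code (Succ1 x y) = prod_encode (1, prod_encode (x, y))"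
| "fo_code (Succ2 x y) = prod_encode (2, prod_encode (x, y))"
| "fo_code (Equal x y) = prod_encode (3, prod_encode (x, y))"
| "fo_code (Neg \<phi>) = prod_encode (4, fo_code \<phi>)"
| "fo_code (Or \<phi> \<psi>) = prod_encode (5, prod_encode (fo_code \<phi>, fo_code \<psi>))"
| "fo_code (Exists x \<phi>) = prod_encode (6, prod_encode (x, fo_code \<phi>))"

lemma inj_fo_code: "inj fo_code"
proof (rule injI)
  fix \<phi> \<psi> assume "fo_code \<phi> = fo_code \<psi>"
  then show "\<phi> = \<psi>"
  proof (induction \<phi> arbitrary: \<psi>)
    case (Pred p x)
    then show ?case by (cases \<psi>) simp_all
  next
    case (Succ1 x y)
    then show ?case by (cases \<psi>) simp_all
  next
    case (Succ2 x y)
    then show ?case by (cases \<psi>) simp_all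
  next
    case (Equal x y)
    then show ?case by (cases \<psi>) simp_all
  next
    case (Neg \<phi>)
    obtain \<phi>' where "\<psi> = Neg \<phi>'" "fo_code \<phi> = fo_code \<phi>'"
      using Neg.prems by (cases \<psi>) simp_all
    then show ?case using Neg.IH by blast
  next
    case (Or \<phi> \<chi>)
    obtain \<phi>' \<chi>' where "\<psi> = Or \<phi>' \<chi>'" "fo_code \<phi> = fo_code \<phi>'" "fo_code \<chi> = fo_code \<chi>'"
      using Or.prems by (cases \<psi>) simp_all
    then show ?case using Or.IH by blast
  next
    case (Exists x \<phi>)
    obtain \<phi>' where "\<psi> = Exists x \<phi>'" "fo_code \<phi> = fo_code \<phi>'"
      using Exists.prems by (cases \<psi>) simp_all
    then show ?case using Exists.IH by blast
  qed
qed

end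

theory Submission imports Defs begin

text \<open>
  A recursive function is compiled to a counter machine, and a machine \<open>P\<close> to a sentence \<open>\<Phi>\<^sub>P\<close> whose models
  are grids: the rows, consecutive in the first order, are the successive configurations, the columns
  are consecutive in the second order, and the two successors suffice to relate each row to the next.
  Conjoined with a sentence \<open>\<nu>\<^sub>n\<close> that sets the input to \<open>n\<close>, \<open>\<Phi>\<^sub>P\<close> is satisfiable if the machine yields 0
  and unsatisfiable if it yields another value. No universal function is needed for the
  diagonalisation: the code of \<open>\<not> \<Phi>\<^sub>P\<close> itself serves as the input. A decision procedure composed
  with the recursive map \<open>k \<mapsto> \<Phi> \<and> \<nu>\<^sub>k\<close>, where \<open>k\<close> codes \<open>\<not> \<Phi>\<close>, gives a total answer on the code \<open>k\<close> of its own
  sentence, and that answer is wrong.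
\<close>

section \<open>Recursive functions of one argument\<close>

definition computable1 :: "(nat \<Rightarrow> nat) \<Rightarrow> bool" where
  "computable1 F \<longleftrightarrow> (\<exists>f. \<forall>n. rec_eval f [n] (F n))"

lemma rec_eval_comp1:
  assumes "rec_eval g xs a" "rec_eval f [a] z"
  shows "rec_eval (RComp f [g]) xs z"
  using assms by (auto intro!: rec_eval.comp[of "[a]"])

lemma rec_eval_comp2:
  assumes "rec_eval g xs a" "rec_eval h xs b" "rec_eval f [a, b] z"
  shows "rec_eval (RComp f [g, h]) xs z"
  using assms by (auto intro!: rec_eval.comp[of "[a, b]"] simp: less_Suc_eq)

lemma rec_eval_RProj: "i < length xs \<Longrightarrow> y = xs ! i \<Longrightarrow> rec_eval (RProj i) xs y"
  by (simp add: rec_eval.proj)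

primrec const_rec :: "nat \<Rightarrow> recf" where
  "const_rec 0 = RZero"
| "const_rec (Suc n) = RComp RSuc [const_rec n]"

lemma rec_eval_const: "rec_eval (const_rec n) xs n"
  by (induction n) (auto intro: rec_eval.zero rec_eval.suc rec_eval_comp1)

definition add_rec :: recf where
  "add_rec = RPrim (RProj 0) (RComp RSuc [RProj 1])"

lemma rec_eval_add: "rec_eval add_rec [m, n] (m + n)"
proof (induction m)
  case 0
  show ?case
    unfolding add_rec_def by (simp add: rec_eval.prim_0 rec_eval_RProj)
next
  case (Suc m)
  have "rec_eval (RComp RSuc [RProj 1]) [m, m + n, n] (Suc m + n)"
    by (rule rec_eval_comp1[of _ _ "m + n"]) (auto intro: rec_eval_RProj rec_eval.suc)
  then show ?case
    using Suc unfolding add_rec_def by (auto intro: rec_eval.prim_Suc)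
qed

definition triangle_rec :: recf where
  "triangle_rec = RPrim RZero (RComp RSuc [add_rec])"

lemma rec_eval_triangle: "rec_eval triangle_rec [n] (triangle n)"
proof (induction n)
  case 0
  show ?case
    unfolding triangle_rec_def by (auto intro: rec_eval.prim_0 rec_eval.zero)
next
  case (Suc n)
  have "rec_eval (RComp RSuc [add_rec]) [n, triangle n] (triangle (Suc n))"
    using rec_eval.suc[of "n + triangle n"]
    by (intro rec_eval_comp1[OF rec_eval_add]) (simp add: add.commute)
  then show ?case
    using Suc unfolding triangle_rec_def by (auto intro: rec_eval.prim_Suc)
qed

definition pair_rec :: recf where
  "pair_rec = RComp add_rec [RComp triangle_rec [add_rec], RProj 0]"

lemma rec_eval_pair: "rec_eval pair_rec [m, n] (prod_encode (m, n))"
proof -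
  have "rec_eval add_rec [triangle (m + n), m] (prod_encode (m, n))"
    using rec_eval_add by (simp add: prod_encode_def)
  then show ?thesis
    unfolding pair_rec_def
    by (intro rec_eval_comp2[OF rec_eval_comp1[OF rec_eval_add rec_eval_triangle]])
      (auto intro: rec_eval_RProj)
qed

lemma computable1_id: "computable1 (\<lambda>n. n)"
  unfolding computable1_def by (auto intro!: exI[of _ "RProj 0"] rec_eval_RProj)

lemma computable1_const: "computable1 (\<lambda>n. c)"
  unfolding computable1_def using rec_eval_const by blast

lemma computable1_pair:
  "computable1 F \<Longrightarrow> computable1 G \<Longrightarrow> computable1 (\<lambda>n. prod_encode (F n, G n))"
  unfolding computable1_def by (meson rec_eval_comp2 rec_eval_pair)

lemma computable1_iterate:
  assumes "computable1 F"
  shows "computable1 (\<lambda>n. (F ^^ n) c)"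
proof -
  obtain f where f: "\<And>n. rec_eval f [n] (F n)"
    using assms unfolding computable1_def by blast
  have "rec_eval (RPrim (const_rec c) (RComp f [RProj 1])) [n] ((F ^^ n) c)" for n
  proof (induction n)
    case 0
    show ?case using rec_eval_const by (auto intro: rec_eval.prim_0)
  next
    case (Suc n)
    have "rec_eval (RComp f [RProj 1]) [n, (F ^^ n) c] ((F ^^ Suc n) c)"
      using f by (auto intro!: rec_eval_comp1 rec_eval_RProj)
    then show ?case using Suc by (auto intro: rec_eval.prim_Suc)
  qed
  then show ?thesis unfolding computable1_def by blast
qed

section \<open>While programs computing recursive functions\<close>

datatype oper = Zero | Keep | Inc | Dec

fun app :: "oper \<Rightarrow> nat \<Rightarrow> nat" where
  "app Zero n = 0"
| "app Keep n = n"
| "app Inc n = Suc n"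
| "app Dec n = n - 1"

datatype com = Assign nat oper nat | Seq com com | While nat com

inductive exec :: "com \<Rightarrow> (nat \<Rightarrow> nat) \<Rightarrow> (nat \<Rightarrow> nat) \<Rightarrow> bool" where
  Assign: "exec (Assign j p i) s (s(j := app p (s i)))"
| Seq: "\<lbrakk>exec c s t; exec d t u\<rbrakk> \<Longrightarrow> exec (Seq c d) s u"
| While_end: "s i = 0 \<Longrightarrow> exec (While i c) s s"
| While_step: "\<lbrakk>s i \<noteq> 0; exec c s t; exec (While i c) t u\<rbrakk> \<Longrightarrow> exec (While i c) s u"

text \<open>
  In \<open>rec_com f args d fr\<close> the arguments are read from the registers \<open>args\<close>, the result goes to
  register \<open>d\<close>, and all registers from \<open>fr\<close> on are scratch space with arbitrary initial contents.
\<close>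

fun rec_com :: "recf \<Rightarrow> nat list \<Rightarrow> nat \<Rightarrow> nat \<Rightarrow> com"
  and rec_coms :: "recf list \<Rightarrow> nat list \<Rightarrow> nat \<Rightarrow> nat \<Rightarrow> com" where
  "rec_com RZero args d fr = Assign d Zero d"
| "rec_com RSuc args d fr = Assign d Inc (hd args)"
| "rec_com (RProj i) args d fr = Assign d Keep (args ! i)"
| "rec_com (RComp f gs) args d fr =
     Seq (rec_coms gs args fr (fr + length gs))
         (rec_com f [fr..<fr + length gs] d (fr + length gs))"
| "rec_com (RPrim f g) args d fr =
     Seq (Assign fr Zero fr)
    (Seq (Assign (fr + 2) Keep (hd args))
    (Seq (rec_com f (tl args) (fr + 1) (fr + 3))
    (Seq (While (fr + 2)
           (Seq (rec_com g (fr # (fr + 1) # tl args) (fr + 1) (fr + 3))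
           (Seq (Assign fr Inc fr)
                (Assign (fr + 2) Dec (fr + 2)))))
         (Assign d Keep (fr + 1)))))"
| "rec_com (RMu f) args d fr =
     Seq (Assign fr Zero fr)
    (Seq (rec_com f (fr # args) (fr + 1) (fr + 2))
    (Seq (While (fr + 1)
           (Seq (Assign fr Inc fr)
                (rec_com f (fr # args) (fr + 1) (fr + 2))))
         (Assign d Keep fr)))"
| "rec_coms [] args d fr = Assign 0 Keep 0"
| "rec_coms (g # gs) args d fr = Seq (rec_com g args d fr) (rec_coms gs args (Suc d) fr)"

definition computes :: "recf \<Rightarrow> nat list \<Rightarrow> nat \<Rightarrow> bool" where
  "computes f xs y \<longleftrightarrow> (\<forall>args d fr s. map s args = xs \<longrightarrow> (\<forall>a \<in> set args. a < fr) \<longrightarrow> d < fr \<longrightarrow>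
     (\<exists>t. exec (rec_com f args d fr) s t \<and> t d = y \<and> (\<forall>r < fr. r \<noteq> d \<longrightarrow> t r = s r)))"

lemma computesD:
  assumes "computes f xs y" "map s args = xs" "\<And>a. a \<in> set args \<Longrightarrow> a < fr" "d < fr"
  obtains t where "exec (rec_com f args d fr) s t" "t d = y" "\<And>r. r < fr \<Longrightarrow> r \<noteq> d \<Longrightarrow> t r = s r"
  using assms unfolding computes_def by blast

lemma exec_rec_coms:
  assumes "length ys = length gs" "\<And>i. i < length gs \<Longrightarrow> computes (gs ! i) xs (ys ! i)"
    "map s args = xs" "\<And>a. a \<in> set args \<Longrightarrow> a < d" "d + length gs \<le> fr"
  shows "\<exists>t. exec (rec_coms gs args d fr) s t \<and> (\<forall>i < length gs. t (d + i) = ys ! i) \<and>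
    (\<forall>r < d. t r = s r)"
  using assms
proof (induction gs arbitrary: ys s d)
  case Nil
  have "exec (rec_coms [] args d fr) s (s(0 := app Keep (s 0)))"
    unfolding rec_coms.simps by (rule exec.Assign)
  then show ?case by auto
next
  case (Cons g gs)
  obtain y zs where ys: "ys = y # zs"
    using Cons.prems(1) by (cases ys) auto
  have "computes g xs y"
    using Cons.prems(2)[of 0] ys by simp
  moreover have "a < fr" if "a \<in> set args" for a
    using Cons.prems(4)[OF that] Cons.prems(5) by simp
  moreover have "d < fr"
    using Cons.prems(5) by simp
  ultimately obtain t where t: "exec (rec_com g args d fr) s t" "t d = y"
    "\<And>r. r < fr \<Longrightarrow> r \<noteq> d \<Longrightarrow> t r = s r"
    using computesD[OF _ Cons.prems(3)] by metis
  have "map t args = xs"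
    using Cons.prems(3,4,5) t(3) by fastforce
  moreover have "computes (gs ! i) xs (zs ! i)" if "i < length gs" for i
    using Cons.prems(2)[of "Suc i"] that ys by simp
  moreover have "a < Suc d" if "a \<in> set args" for a
    using Cons.prems(4)[OF that] by simp
  ultimately obtain u where u: "exec (rec_coms gs args (Suc d) fr) t u"
    "\<forall>i < length gs. u (Suc d + i) = zs ! i" "\<forall>r < Suc d. u r = t r"
    using Cons.IH[of zs t "Suc d"] Cons.prems(1,5) ys by auto
  have "u (d + i) = ys ! i" if "i < length (g # gs)" for i
    using that u t(2) ys by (cases i) auto
  moreover have "u r = s r" if "r < d" for r
    using that u(3) t(3)[of r] Cons.prems(5) by auto
  ultimately show ?case
    using exec.Seq[OF t(1) u(1)] by auto
qed

lemma rec_eval_PrimD: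
  assumes "rec_eval (RPrim f g) (n # xs) y"
  obtains Y where "rec_eval f xs (Y 0)" "\<And>k. k < n \<Longrightarrow> rec_eval g (k # Y k # xs) (Y (Suc k))" "Y n = y"
proof -
  have "\<exists>Y. rec_eval f xs (Y 0) \<and> (\<forall>k < n. rec_eval g (k # Y k # xs) (Y (Suc k))) \<and> Y n = y"
    using assms
  proof (induction n arbitrary: y)
    case 0
    then have "rec_eval f xs y" by (elim rec_eval_elims)
    then show ?case by (intro exI[of _ "\<lambda>_. y"]) simp
  next
    case (Suc n)
    then obtain z where z: "rec_eval (RPrim f g) (n # xs) z" "rec_eval g (n # z # xs) y"
      by (elim rec_eval_elims)
    obtain Y where "rec_eval f xs (Y 0)" "\<forall>k < n. rec_eval g (k # Y k # xs) (Y (Suc k))" "Y n = z"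
      using Suc.IH[OF z(1)] by blast
    then show ?case
      using z(2) by (intro exI[of _ "Y(Suc n := y)"]) (auto simp: less_Suc_eq)
  qed
  then show thesis using that by blast
qed

lemma computes_Prim:
  assumes f: "\<And>xs y. rec_eval f xs y \<Longrightarrow> computes f xs y"
    and g: "\<And>xs y. rec_eval g xs y \<Longrightarrow> computes g xs y"
    and ev: "rec_eval (RPrim f g) (n # xs) y"
  shows "computes (RPrim f g) (n # xs) y"
  unfolding computes_def
proof (intro allI impI)
  fix args d fr and s :: "nat \<Rightarrow> nat"
  assume args: "map s args = n # xs" "\<forall>a \<in> set args. a < fr" and d: "d < fr"
  obtain a as where as: "args = a # as" "s a = n" "map s as = xs"
    using args(1) by auto
  obtain Y where Y: "rec_eval f xs (Y 0)" "\<And>k. k < n \<Longrightarrow> rec_eval g (k # Y k # xs) (Y (Suc k))" "Y n = y"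
    using rec_eval_PrimD[OF ev] by blast
  let ?body = "Seq (rec_com g (fr # (fr + 1) # as) (fr + 1) (fr + 3))
    (Seq (Assign fr Inc fr) (Assign (fr + 2) Dec (fr + 2)))"
  have loop: "\<exists>u. exec (While (fr + 2) ?body) t u \<and> u (fr + 1) = y \<and> (\<forall>r < fr. u r = t r)"
    if "t fr = k" "t (fr + 1) = Y k" "t (fr + 2) = n - k" "k \<le> n" "map t as = xs" for k t
    using that
  proof (induction "n - k" arbitrary: k t)
    case 0
    then show ?case using exec.While_end[of t "fr + 2" ?body] Y(3) by auto
  next
    case (Suc m)
    have k: "k < n" using Suc.hyps(2) by simp
    have "map t (fr # (fr + 1) # as) = k # Y k # xs" using Suc.prems by simp
    moreover have "b < fr + 3" if "b \<in> set (fr # (fr + 1) # as)" for b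
      using that args(2) as(1) by fastforce
    ultimately obtain v where v: "exec (rec_com g (fr # (fr + 1) # as) (fr + 1) (fr + 3)) t v"
      "v (fr + 1) = Y (Suc k)" "\<And>r. r < fr + 3 \<Longrightarrow> r \<noteq> fr + 1 \<Longrightarrow> v r = t r"
      using computesD[OF g[OF Y(2)[OF k]], of t "fr # (fr + 1) # as" "fr + 3" "fr + 1"] by auto
    define v1 where "v1 = v(fr := app Inc (v fr))"
    define w where "w = v1(fr + 2 := app Dec (v1 (fr + 2)))"
    have ex: "exec ?body t w"
      unfolding w_def v1_def by (rule exec.Seq[OF v(1) exec.Seq[OF exec.Assign exec.Assign]])
    have w: "w fr = Suc k" "w (fr + 1) = Y (Suc k)" "w (fr + 2) = n - Suc k"
      using v Suc.prems unfolding w_def v1_def by auto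
    have low: "w r = t r" if "r < fr" for r
      using v(3) that unfolding w_def v1_def by auto
    have "map w as = xs"
      using Suc.prems(5) args(2) as(1) low by auto
    then obtain u where u: "exec (While (fr + 2) ?body) w u" "u (fr + 1) = y" "\<forall>r < fr. u r = w r"
      using Suc.hyps(1)[OF _ w _ \<open>map w as = xs\<close>] Suc.hyps(2) k by fastforce
    have "exec (While (fr + 2) ?body) t u"
      using Suc.prems(3) k by (intro exec.While_step[OF _ ex u(1)]) simp
    then show ?case
      using u(2,3) low by auto
  qed
  define s1 where "s1 = s(fr := app Zero (s fr))"
  define s2 where "s2 = s1(fr + 2 := app Keep (s1 a))"
  have s2: "s2 fr = 0" "s2 (fr + 2) = n" "s2 r = s r" if "r < fr" for r
    using as args(2) that unfolding s1_def s2_def by auto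
  have "map s2 as = xs"
    using as args(2) s2(3) by auto
  moreover have "b < fr + 3" if "b \<in> set as" for b
    using that args(2) as(1) by fastforce
  ultimately obtain t where t: "exec (rec_com f as (fr + 1) (fr + 3)) s2 t" "t (fr + 1) = Y 0"
    "\<And>r. r < fr + 3 \<Longrightarrow> r \<noteq> fr + 1 \<Longrightarrow> t r = s2 r"
    using computesD[OF f[OF Y(1)], of s2 as "fr + 3" "fr + 1"] by auto
  have "map t as = xs"
    using \<open>map s2 as = xs\<close> args(2) as(1) t(3) by fastforce
  then obtain u where u: "exec (While (fr + 2) ?body) t u" "u (fr + 1) = y" "\<forall>r < fr. u r = t r"
    using loop[of t 0] t(2) t(3)[of fr] t(3)[of "fr + 2"] s2(1,2)[OF d] by auto
  have "exec (rec_com (RPrim f g) args d fr) s (u(d := app Keep (u (fr + 1))))"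
    unfolding rec_com.simps as(1) list.sel
    by (intro exec.Seq[OF exec.Assign[of fr Zero fr s, folded s1_def]]
        exec.Seq[OF exec.Assign[of "fr + 2" Keep a s1, folded s2_def]]
        exec.Seq[OF t(1)] exec.Seq[OF u(1)] exec.Assign)
  moreover have "(u(d := app Keep (u (fr + 1)))) d = y"
    using u(2) by simp
  moreover have "\<forall>r < fr. r \<noteq> d \<longrightarrow> (u(d := app Keep (u (fr + 1)))) r = s r"
    using u(3) t(3) s2(3) by simp
  ultimately show "\<exists>t. exec (rec_com (RPrim f g) args d fr) s t \<and> t d = y \<and> (\<forall>r < fr. r \<noteq> d \<longrightarrow> t r = s r)"
    by blast
qed

lemma computes_Mu:
  assumes f: "\<And>xs y. rec_eval f xs y \<Longrightarrow> computes f xs y"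
    and ev: "rec_eval (RMu f) xs n"
  shows "computes (RMu f) xs n"
  unfolding computes_def
proof (intro allI impI)
  fix args d fr and s :: "nat \<Rightarrow> nat"
  assume args: "map s args = xs" "\<forall>a \<in> set args. a < fr" and d: "d < fr"
  have "rec_eval f (n # xs) 0" "\<forall>m < n. \<exists>y. rec_eval f (m # xs) (Suc y)"
    using ev by (auto elim: rec_eval_elims(7))
  then have "\<forall>m. \<exists>y. m \<le> n \<longrightarrow> rec_eval f (m # xs) y \<and> (y = 0 \<longleftrightarrow> m = n)"
    by (metis le_neq_implies_less nat.distinct(1))
  then obtain V where V: "\<And>m. m \<le> n \<Longrightarrow> rec_eval f (m # xs) (V m)" "\<And>m. m \<le> n \<Longrightarrow> V m = 0 \<longleftrightarrow> m = n"
    by metis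
  let ?f = "rec_com f (fr # args) (fr + 1) (fr + 2)"
  let ?body = "Seq (Assign fr Inc fr) ?f"
  have run_f: "\<exists>v. exec ?f t v \<and> v fr = k \<and> v (fr + 1) = V k \<and> (\<forall>r < fr. v r = t r)"
    if t: "t fr = k" "k \<le> n" "map t args = xs" for k t
  proof -
    have "\<And>b. b \<in> set (fr # args) \<Longrightarrow> b < fr + 2"
      using args(2) by fastforce
    then obtain v where "exec ?f t v" "v (fr + 1) = V k" "\<And>r. r < fr + 2 \<Longrightarrow> r \<noteq> fr + 1 \<Longrightarrow> v r = t r"
      using computesD[OF f[OF V(1)[OF t(2)]], of t "fr # args" "fr + 2" "fr + 1"] t by auto
    then show ?thesis using t(1) by auto
  qed
  have loop: "\<exists>u. exec (While (fr + 1) ?body) t u \<and> u fr = n \<and> (\<forall>r < fr. u r = t r)"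
    if "t fr = k" "t (fr + 1) = V k" "k \<le> n" "map t args = xs" for k t
    using that
  proof (induction "n - k" arbitrary: k t)
    case 0
    then show ?case using exec.While_end[of t "fr + 1" ?body] V(2) by auto
  next
    case (Suc m)
    define t1 where "t1 = t(fr := app Inc (t fr))"
    have t1: "exec (Assign fr Inc fr) t t1" "t1 fr = Suc k" "\<And>r. r < fr \<Longrightarrow> t1 r = t r"
      using Suc.prems(1) exec.Assign[of fr Inc fr t] unfolding t1_def by auto
    have "map t1 args = xs" using Suc.prems(4) args(2) t1(3) by auto
    then obtain v where v: "exec ?f t1 v" "v fr = Suc k" "v (fr + 1) = V (Suc k)" "\<forall>r < fr. v r = t1 r"
      using run_f[of t1 "Suc k", OF t1(2)] Suc.hyps(2) by fastforce
    have "map v args = xs" using \<open>map t1 args = xs\<close> args(2) v(4) by auto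
    then obtain u where u: "exec (While (fr + 1) ?body) v u" "u fr = n" "\<forall>r < fr. u r = v r"
      using Suc.hyps(1)[OF _ v(2,3)] Suc.hyps(2) by fastforce
    have "t (fr + 1) \<noteq> 0"
      using Suc.prems(2) Suc.hyps(2) V(2)[of k] by auto
    then have "exec (While (fr + 1) ?body) t u"
      by (rule exec.While_step[OF _ exec.Seq[OF t1(1) v(1)] u(1)])
    then show ?case
      using u(2,3) v(4) t1(3) by auto
  qed
  define s1 where "s1 = s(fr := app Zero (s fr))"
  have s1: "s1 fr = 0" "\<And>r. r < fr \<Longrightarrow> s1 r = s r"
    unfolding s1_def by auto
  have "map s1 args = xs" using args s1(2) by auto
  then obtain t where t: "exec ?f s1 t" "t fr = 0" "t (fr + 1) = V 0" "\<forall>r < fr. t r = s1 r"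
    using run_f[of s1 0] s1(1) by auto
  have "map t args = xs" using \<open>map s1 args = xs\<close> args(2) t(4) by auto
  then obtain u where u: "exec (While (fr + 1) ?body) t u" "u fr = n" "\<forall>r < fr. u r = t r"
    using loop[of t 0] t by auto
  have "exec (rec_com (RMu f) args d fr) s (u(d := app Keep (u fr)))"
    unfolding rec_com.simps
    by (intro exec.Seq[OF exec.Assign[of fr Zero fr s, folded s1_def]]
        exec.Seq[OF t(1)] exec.Seq[OF u(1)] exec.Assign)
  moreover have "(u(d := app Keep (u fr))) d = n"
    using u(2) by simp
  moreover have "\<forall>r < fr. r \<noteq> d \<longrightarrow> (u(d := app Keep (u fr))) r = s r"
    using u(3) t(4) s1(2) by simp
  ultimately show "\<exists>t. exec (rec_com (RMu f) args d fr) s t \<and> t d = n \<and> (\<forall>r < fr. r \<noteq> d \<longrightarrow> t r = s r)"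
    by blast
qed

lemma computes_Comp:
  assumes f: "\<And>xs y. rec_eval f xs y \<Longrightarrow> computes f xs y"
    and gs: "\<And>g xs y. g \<in> set gs \<Longrightarrow> rec_eval g xs y \<Longrightarrow> computes g xs y"
    and ev: "rec_eval (RComp f gs) xs z"
  shows "computes (RComp f gs) xs z"
  unfolding computes_def
proof (intro allI impI)
  fix args d fr and s :: "nat \<Rightarrow> nat"
  assume args: "map s args = xs" "\<forall>a \<in> set args. a < fr" and d: "d < fr"
  obtain ys where ys: "length ys = length gs" "\<forall>i < length gs. rec_eval (gs ! i) xs (ys ! i)" "rec_eval f ys z"
    using ev by (elim rec_eval_elims)
  let ?fr = "fr + length gs"
  obtain t where t: "exec (rec_coms gs args fr ?fr) s t"
    "\<forall>i < length gs. t (fr + i) = ys ! i" "\<forall>r < fr. t r = s r"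
    using exec_rec_coms[OF ys(1) _ args(1), of fr ?fr] gs ys(2) args(2) by auto
  have "map t [fr..<?fr] = ys"
    using ys(1) t(2) by (intro nth_equalityI) auto
  moreover have "a < ?fr" if "a \<in> set [fr..<?fr]" for a
    using that by simp
  ultimately obtain u where u: "exec (rec_com f [fr..<?fr] d ?fr) t u" "u d = z"
    "\<And>r. r < ?fr \<Longrightarrow> r \<noteq> d \<Longrightarrow> u r = t r"
    using computesD[OF f[OF ys(3)], of t "[fr..<?fr]" ?fr d] d by auto
  then show "\<exists>t. exec (rec_com (RComp f gs) args d fr) s t \<and> t d = z \<and> (\<forall>r < fr. r \<noteq> d \<longrightarrow> t r = s r)"
    using exec.Seq[OF t(1) u(1)] t(3) by auto
qed

lemma rec_eval_computes: "rec_eval f xs y \<Longrightarrow> computes f xs y"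
proof (induction f arbitrary: xs y)
  case RZero
  then have y: "y = 0" by (elim rec_eval_elims)
  show ?case
    unfolding computes_def rec_com.simps
    using exec.Assign[of _ Zero] y by fastforce
next
  case RSuc
  then obtain x where xs: "xs = [x]" "y = Suc x" by (elim rec_eval_elims)
  show ?case
    unfolding computes_def
  proof (intro allI impI)
    fix args d fr and s :: "nat \<Rightarrow> nat"
    assume "map s args = xs"
    then have "s (hd args) = x" using xs(1) by auto
    then show "\<exists>t. exec (rec_com RSuc args d fr) s t \<and> t d = y \<and> (\<forall>r < fr. r \<noteq> d \<longrightarrow> t r = s r)"
      using exec.Assign[of d Inc "hd args" s] xs(2)
      by (intro exI[of _ "s(d := Suc x)"]) auto
  qed
next
  case (RProj i)
  then have y: "i < length xs" "y = xs ! i" by (auto elim: rec_eval_elims)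
  show ?case
    unfolding computes_def
  proof (intro allI impI)
    fix args d fr and s :: "nat \<Rightarrow> nat"
    assume "map s args = xs"
    then have "s (args ! i) = y" using y by auto
    then show "\<exists>t. exec (rec_com (RProj i) args d fr) s t \<and> t d = y \<and> (\<forall>r < fr. r \<noteq> d \<longrightarrow> t r = s r)"
      using exec.Assign[of d Keep "args ! i" s]
      by (intro exI[of _ "s(d := y)"]) auto
  qed
next
  case (RComp f gs)
  then show ?case using computes_Comp by blast
next
  case (RPrim f g)
  from RPrim.prems obtain n zs where "xs = n # zs"
    by (cases rule: rec_eval.cases) auto
  then show ?case using computes_Prim RPrim by blast
next
  case (RMu f)
  then show ?case using computes_Mu by blast
qed

section \<open>Flat programs\<close>

text \<open>
  \<open>Ins j p i b t1 t2\<close> assigns \<open>p\<close> applied to register \<open>i\<close> to register \<open>j\<close> and jumps to \<open>t1\<close> or \<open>t2\<close>,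
  depending on whether register \<open>b\<close> was nonzero or zero before the assignment.
\<close>

datatype instr = Ins nat oper nat nat nat nat

inductive mstep :: "instr list \<Rightarrow> nat \<times> (nat \<Rightarrow> nat) \<Rightarrow> nat \<times> (nat \<Rightarrow> nat) \<Rightarrow> bool" for P where
  "\<lbrakk>a < length P; P ! a = Ins j p i b t1 t2\<rbrakk>
    \<Longrightarrow> mstep P (a, s) (if s b \<noteq> 0 then t1 else t2, s(j := app p (s i)))"

lemma mstepI:
  assumes "a < length P" "P ! a = Ins j p i b t1 t2"
    "a' = (if s b \<noteq> 0 then t1 else t2)" "s' = s(j := app p (s i))"
  shows "mstep P (a, s) (a', s')"
  using mstep.intros[OF assms(1,2)] assms(3,4) by simp

fun code :: "com \<Rightarrow> nat \<Rightarrow> instr list" where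
  "code (Assign j p i) a = [Ins j p i 0 (Suc a) (Suc a)]"
| "code (Seq c d) a = (let C = code c a in C @ code d (a + length C))"
| "code (While i c) a =
     (let C = code c (Suc a)
      in Ins 0 Keep 0 i (Suc a) (a + length C + 2) # C @ [Ins 0 Keep 0 0 a a])"

definition code_at :: "instr list \<Rightarrow> nat \<Rightarrow> instr list \<Rightarrow> bool" where
  "code_at P a C \<longleftrightarrow> (\<forall>k < length C. a + k < length P \<and> P ! (a + k) = C ! k)"

lemma code_at_Nil: "code_at P a []"
  by (simp add: code_at_def)

lemma code_at_Cons: "code_at P a (x # C) \<longleftrightarrow> a < length P \<and> P ! a = x \<and> code_at P (Suc a) C"
  unfolding code_at_def by (auto simp: nth_Cons less_Suc_eq_0_disj split: nat.splits)

lemma code_at_append: "code_at P a (C @ D) \<longleftrightarrow> code_at P a C \<and> code_at P (a + length C) D"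
  by (induction C arbitrary: a) (auto simp: code_at_Cons code_at_Nil)

lemma exec_code:
  assumes "exec c s t" "code_at P a (code c a)"
  shows "(mstep P)\<^sup>*\<^sup>* (a, s) (a + length (code c a), t)"
  using assms
proof (induction arbitrary: a rule: exec.induct)
  case (Assign j p i s)
  then have "mstep P (a, s) (Suc a, s(j := app p (s i)))"
    by (intro mstepI) (auto simp: code_at_Cons)
  then show ?case by (simp del: fun_upd_apply add: r_into_rtranclp)
next
  case (Seq c s t d u)
  let ?b = "a + length (code c a)"
  have "(mstep P)\<^sup>*\<^sup>* (a, s) (?b, t)" "(mstep P)\<^sup>*\<^sup>* (?b, t) (?b + length (code d ?b), u)"
    using Seq by (simp_all add: code_at_append Let_def)
  then show ?case by (simp add: Let_def add.assoc)
next
  case (While_end s i c)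
  then have "mstep P (a, s) (a + length (code (While i c) a), s)"
    by (intro mstepI) (auto simp: code_at_Cons Let_def)
  then show ?case by auto
next
  case (While_step s i c t u)
  let ?b = "Suc a + length (code c (Suc a))"
  have at: "a < length P" "P ! a = Ins 0 Keep 0 i (Suc a) (a + length (code c (Suc a)) + 2)"
    "code_at P (Suc a) (code c (Suc a))" "?b < length P" "P ! ?b = Ins 0 Keep 0 0 a a"
    using While_step.prems by (auto simp: code_at_append code_at_Cons Let_def)
  have "mstep P (a, s) (Suc a, s)"
    using While_step.hyps(1) by (intro mstepI[OF at(1,2)]) auto
  moreover have "(mstep P)\<^sup>*\<^sup>* (Suc a, s) (?b, t)"
    using While_step.IH(1)[OF at(3)] .
  moreover have "mstep P (?b, t) (a, t)"
    by (intro mstepI[OF at(4,5)]) auto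
  moreover have "(mstep P)\<^sup>*\<^sup>* (a, t) (a + length (code (While i c) a), u)"
    using While_step.IH(2)[OF While_step.prems] .
  ultimately show ?case
    by (meson converse_rtranclp_into_rtranclp rtranclp_trans)
qed

text \<open>
  The address \<open>length (rec_prog f)\<close> is the rejecting one, reached for a nonzero result;
  \<open>Suc (length (rec_prog f))\<close> is the accepting one.
\<close>

definition rec_prog :: "recf \<Rightarrow> instr list" where
  "rec_prog f = (let C = code (rec_com f [0] 1 2) 0
     in C @ [Ins 0 Keep 0 1 (length C + 1) (length C + 2)])"

lemma rec_prog_run:
  assumes "rec_eval f [n] y" "s 0 = n"
  shows "\<exists>t. (mstep (rec_prog f))\<^sup>*\<^sup>* (0, s)
    (if y = 0 then Suc (length (rec_prog f)) else length (rec_prog f), t)"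
proof -
  let ?C = "code (rec_com f [0] 1 2) 0" and ?P = "rec_prog f"
  obtain t where t: "exec (rec_com f [0] 1 2) s t" "t 1 = y"
    using computesD[OF rec_eval_computes[OF assms(1)], of s "[0]" 2 1] assms(2) by auto
  have "code_at ?P 0 ?C"
    unfolding rec_prog_def code_at_def by (simp add: Let_def nth_append)
  then have "(mstep ?P)\<^sup>*\<^sup>* (0, s) (length ?C, t)"
    using exec_code[OF t(1)] by fastforce
  moreover have "mstep ?P (length ?C, t) (if y = 0 then Suc (length ?P) else length ?P, t)"
    using t(2) by (intro mstepI[of _ _ 0 Keep 0 1 "length ?C + 1" "length ?C + 2"])
      (auto simp: rec_prog_def Let_def nth_append)
  ultimately show ?thesis
    by (meson rtranclp.rtrancl_into_rtrancl)
qed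


section \<open>Formulas of the one-dimensional fragment\<close>

definition And :: "fo \<Rightarrow> fo \<Rightarrow> fo" where
  "And \<phi> \<psi> = Neg (Or (Neg \<phi>) (Neg \<psi>))"

definition Imp :: "fo \<Rightarrow> fo \<Rightarrow> fo" where
  "Imp \<phi> \<psi> = Or (Neg \<phi>) \<psi>"

definition Iff :: "fo \<Rightarrow> fo \<Rightarrow> fo" where
  "Iff \<phi> \<psi> = And (Imp \<phi> \<psi>) (Imp \<psi> \<phi>)"

definition Conj :: "fo list \<Rightarrow> fo" where
  "Conj \<phi>s = foldr And \<phi>s (Neg (Exists 0 (Neg (Equal 0 0))))"

definition All :: "fo \<Rightarrow> fo" where
  "All \<phi> = Neg (Exists_block [0, 1, 2, 3] (Neg \<phi>))"

declare F1.Pred [simp] F1.Succ1 [simp] F1.Succ2 [simp] F1.Equal [simp] F1.Neg [simp] F1.Or [simp]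

lemma And_simps [simp]:
  "\<phi> \<in> F1 \<Longrightarrow> \<psi> \<in> F1 \<Longrightarrow> And \<phi> \<psi> \<in> F1" "fv (And \<phi> \<psi>) = fv \<phi> \<union> fv \<psi>"
  "sat M \<sigma> (And \<phi> \<psi>) \<longleftrightarrow> sat M \<sigma> \<phi> \<and> sat M \<sigma> \<psi>"
  by (auto simp: And_def)

lemma Imp_simps [simp]:
  "\<phi> \<in> F1 \<Longrightarrow> \<psi> \<in> F1 \<Longrightarrow> Imp \<phi> \<psi> \<in> F1" "fv (Imp \<phi> \<psi>) = fv \<phi> \<union> fv \<psi>"
  "sat M \<sigma> (Imp \<phi> \<psi>) \<longleftrightarrow> (sat M \<sigma> \<phi> \<longrightarrow> sat M \<sigma> \<psi>)"
  by (auto simp: Imp_def)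

lemma Iff_simps [simp]:
  "\<phi> \<in> F1 \<Longrightarrow> \<psi> \<in> F1 \<Longrightarrow> Iff \<phi> \<psi> \<in> F1" "fv (Iff \<phi> \<psi>) = fv \<phi> \<union> fv \<psi>"
  "sat M \<sigma> (Iff \<phi> \<psi>) \<longleftrightarrow> (sat M \<sigma> \<phi> \<longleftrightarrow> sat M \<sigma> \<psi>)"
  by (auto simp: Iff_def)

lemma Exists_in_F1:
  assumes "\<phi> \<in> F1" "fv \<phi> \<subseteq> {x, y}"
  shows "Exists x \<phi> \<in> F1"
proof (cases "x = y")
  case True
  then show ?thesis
    using F1.Exists_all[of \<phi> x "[]"] assms by (simp add: Exists_block_def)
next
  case False
  then show ?thesis
    using F1.Exists_all_but_one[of \<phi> y "[x]"] assms by (simp add: Exists_block_def insert_commute)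
qed

lemma Conj_simps [simp]:
  "set \<phi>s \<subseteq> F1 \<Longrightarrow> Conj \<phi>s \<in> F1" "fv (Conj \<phi>s) = (\<Union>\<phi> \<in> set \<phi>s. fv \<phi>)"
  "sat M \<sigma> (Conj \<phi>s) \<longleftrightarrow> (\<forall>\<phi> \<in> set \<phi>s. sat M \<sigma> \<phi>)"
  using Exists_in_F1[of "Neg (Equal 0 0)" 0 0] unfolding Conj_def by (induction \<phi>s) auto

lemma All_simps [simp]:
  "\<phi> \<in> F1 \<Longrightarrow> fv \<phi> \<subseteq> {0, 1, 2, 3} \<Longrightarrow> All \<phi> \<in> F1" "fv (All \<phi>) = fv \<phi> - {0, 1, 2, 3}"
  "sat M \<sigma> (All \<phi>) \<longleftrightarrow> (\<forall>x \<in> carrier M. \<forall>x' \<in> carrier M. \<forall>y \<in> carrier M. \<forall>y' \<in> carrier M.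
     sat M (\<sigma>(0 := x, 1 := x', 2 := y, 3 := y')) \<phi>)"
  using F1.Exists_all[of "Neg \<phi>" 0 "[1, 2, 3]"] by (auto simp: All_def Exists_block_def)

section \<open>The formula of a flat program\<close>

text \<open>
  A computation is laid out as a grid whose rows, traversed by the first successor, are the
  configurations, and whose columns are traversed by the second. The predicates \<open>Lft\<close> and \<open>Rgt\<close> mark
  the borders, \<open>St q\<close> marks all cells of a row at address \<open>q\<close>, and \<open>Reg r\<close> marks an initial segment of
  the row whose length is the value of register \<open>r\<close>. In the formulas, 0 and 1 denote neighbours in a
  row, and 2 and 3 the cells below them.
\<close>

definition lft :: "nat" where "lft = 0"
definition rgt :: "nat" where "rgt = 1"
definition reg :: "nat \<Rightarrow> nat" where "reg r = 2 * r + 2"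
definition st :: "nat \<Rightarrow> nat" where "st q = 2 * q + 3"

abbreviation "Lft \<equiv> Pred lft"
abbreviation "Rgt \<equiv> Pred rgt"
abbreviation "Reg r \<equiv> Pred (reg r)"
abbreviation "St q \<equiv> Pred (st q)"

fun oper_fo :: "nat \<Rightarrow> nat \<Rightarrow> oper \<Rightarrow> nat \<Rightarrow> fo" where
  "oper_fo q r Zero i = All (Imp (Conj [St q 0, Succ2 0 2]) (Neg (Reg r 2)))"
| "oper_fo q r Keep i = All (Imp (Conj [St q 0, Succ2 0 2]) (Iff (Reg r 2) (Reg i 0)))"
| "oper_fo q r Inc i =
     And (All (Imp (Conj [St q 0, Succ2 0 2, Lft 0]) (Reg r 2)))
         (All (Imp (Conj [St q 0, Neg (Rgt 0), Succ1 0 1, Succ2 1 3]) (Iff (Reg r 3) (Reg i 0))))"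
| "oper_fo q r Dec i =
     All (Imp (Conj [St q 0, Neg (Rgt 0), Succ1 0 1, Succ2 0 2]) (Iff (Reg r 2) (Reg i 1)))"

fun instr_fo :: "nat \<Rightarrow> nat \<Rightarrow> instr \<Rightarrow> fo" where
  "instr_fo N q (Ins j p i b t1 t2) = Conj
    ([All (Imp (St q 0) (Exists 2 (Succ2 0 2))),
      All (Imp (Conj [St q 0, Neg (Rgt 0), Succ1 0 1, Succ2 0 2, Succ2 1 3]) (Succ1 2 3)),
      All (Imp (Conj [St q 0, Succ2 0 2]) (And (Iff (Lft 2) (Lft 0)) (Iff (Rgt 2) (Rgt 0)))),
      All (Imp (Conj [St q 0, Succ2 0 2, Lft 0, Reg b 0]) (St t1 2)),
      All (Imp (Conj [St q 0, Succ2 0 2, Lft 0, Neg (Reg b 0)]) (St t2 2))]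
     @ map (\<lambda>r. oper_fo q r (if r = j then p else Keep) (if r = j then i else r)) [0..<N])"

definition row_fo :: "nat \<Rightarrow> fo" where
  "row_fo N = Conj
    ([All (Imp (Neg (Rgt 0)) (Exists 1 (Succ1 0 1)))]
     @ map (\<lambda>r. All (Imp (Rgt 0) (Neg (Reg r 0)))) [0..<N]
     @ map (\<lambda>r. All (Imp (Conj [Neg (Rgt 0), Succ1 0 1, Reg r 1]) (Reg r 0))) [0..<N]
     @ map (\<lambda>q. All (Imp (Conj [Neg (Rgt 0), Succ1 0 1, St q 0]) (St q 1))) [0..<N])"

definition prog_fo :: "nat \<Rightarrow> instr list \<Rightarrow> fo" where
  "prog_fo N P = Conj
    (row_fo N # All (Neg (St (length P) 0)) # map (\<lambda>q. instr_fo N q (P ! q)) [0..<length P])"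

primrec segment_fo :: "nat \<Rightarrow> fo" where
  "segment_fo 0 = Neg (Reg 0 0)"
| "segment_fo (Suc n) =
     And (Reg 0 0) (Exists 1 (And (Succ1 0 1) (Exists 0 (And (Equal 0 1) (segment_fo n)))))"

definition input_fo :: "nat \<Rightarrow> fo" where
  "input_fo n = Exists 0 (And (And (Lft 0) (St 0 0)) (segment_fo n))"

lemma oper_fo_F1: "oper_fo q r p i \<in> F1 \<and> fv (oper_fo q r p i) = {}"
  by (cases p) simp_all

lemma instr_fo_F1: "instr_fo N q I \<in> F1 \<and> fv (instr_fo N q I) = {}"
proof -
  have "Exists 2 (Succ2 0 2) \<in> F1"
    by (rule Exists_in_F1[of _ _ 0]) auto
  then show ?thesis by (cases I) (auto simp: oper_fo_F1 intro!: Conj_simps(1) All_simps(1))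
qed

lemma row_fo_F1: "row_fo N \<in> F1 \<and> fv (row_fo N) = {}"
proof -
  have "Exists 1 (Succ1 0 1) \<in> F1"
    by (rule Exists_in_F1[of _ _ 0]) auto
  then show ?thesis by (auto simp: row_fo_def intro!: Conj_simps(1) All_simps(1))
qed

lemma prog_fo_F1: "prog_fo N P \<in> F1 \<and> fv (prog_fo N P) = {}"
  unfolding prog_fo_def using row_fo_F1 instr_fo_F1 by (auto intro!: Conj_simps(1))

lemma segment_fo_F1: "segment_fo n \<in> F1 \<and> fv (segment_fo n) = {0}"
proof (induction n)
  case (Suc n)
  have "Exists 0 (And (Equal 0 1) (segment_fo n)) \<in> F1"
    by (rule Exists_in_F1[of _ _ 1]) (simp_all add: Suc)
  then have "Exists 1 (And (Succ1 0 1) (Exists 0 (And (Equal 0 1) (segment_fo n)))) \<in> F1"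
    by (intro Exists_in_F1[of _ _ 0]) (simp_all add: Suc)
  then show ?case
    using Suc by auto
qed simp

lemma input_fo_F1: "input_fo n \<in> F1 \<and> fv (input_fo n) = {}"
proof -
  have "input_fo n \<in> F1"
    unfolding input_fo_def by (rule Exists_in_F1[of _ _ 0]) (simp_all add: segment_fo_F1)
  then show ?thesis
    by (simp add: input_fo_def segment_fo_F1)
qed

lemma computable1_input_fo: "computable1 (\<lambda>n. fo_code (input_fo n))"
proof -
  define pand where "pand x y =
    prod_encode (4, prod_encode (5, prod_encode (prod_encode (4, x), prod_encode (4, y))))" for x y
  have code_And: "fo_code (And \<phi> \<psi>) = pand (fo_code \<phi>) (fo_code \<psi>)" for \<phi> \<psi>
    by (simp add: And_def pand_def)
  define F where "F x = pand (fo_code (Reg 0 0)) (prod_encode (6, prod_encode (1, pand (fo_code (Succ1 0 1))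
    (prod_encode (6, prod_encode (0, pand (fo_code (Equal 0 1)) x))))))" for x
  have comp_pand: "computable1 (\<lambda>n. pand (f n) (g n))" if "computable1 f" "computable1 g" for f g
    unfolding pand_def by (intro computable1_pair computable1_const that)
  have "computable1 F"
    unfolding F_def by (intro computable1_pair computable1_const computable1_id comp_pand)
  moreover have "fo_code (segment_fo n) = (F ^^ n) (fo_code (Neg (Reg 0 0)))" for n
    by (induction n) (simp_all add: F_def code_And)
  ultimately have "computable1 (\<lambda>n. fo_code (segment_fo n))"
    using computable1_iterate by simp
  then show ?thesis
    unfolding input_fo_def fo_code.simps code_And
    by (intro computable1_pair computable1_const comp_pand)
qed

fun instr_bound :: "nat \<Rightarrow> instr \<Rightarrow> bool" where
  "instr_bound N (Ins j p i b t1 t2) \<longleftrightarrow> j < N \<and> i < N \<and> b < N \<and> t1 < N \<and> t2 < N"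

definition prog_bound :: "nat \<Rightarrow> instr list \<Rightarrow> bool" where
  "prog_bound N P \<longleftrightarrow> length P + 1 < N \<and> (\<forall>I \<in> set P. instr_bound N I)"

lemma instr_bound_mono: "instr_bound N I \<Longrightarrow> N \<le> N' \<Longrightarrow> instr_bound N' I"
  by (cases I) auto

lemma ex_prog_bound: "\<exists>N. prog_bound N P"
proof -
  have "\<exists>N. instr_bound N I" for I
  proof (cases I)
    case (Ins j p i b t1 t2)
    then have "instr_bound (Suc (j + i + b + t1 + t2)) I" by simp
    then show ?thesis ..
  qed
  then obtain g where g: "\<And>I. instr_bound (g I) I"
    by metis
  let ?N = "sum_list (map g P) + length P + 2"
  have "instr_bound ?N I" if "I \<in> set P" for I
  proof (rule instr_bound_mono[OF g])
    show "g I \<le> ?N" using that member_le_sum_list[of "g I" "map g P"] by simp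
  qed
  then have "prog_bound ?N P"
    by (simp add: prog_bound_def)
  then show ?thesis ..
qed

lemma finite_structure_subsets:
  assumes "finite_structure M"
  shows "carrier M \<noteq> {}" "unary M p \<subseteq> carrier M"
    "succ1 M \<subseteq> carrier M \<times> carrier M" "succ2 M \<subseteq> carrier M \<times> carrier M"
  using assms is_successor_on_subset[of "carrier M" "succ1 M"] is_successor_on_subset[of "carrier M" "succ2 M"]
  unfolding finite_structure_def by simp_all

lemma is_successor_on_functional:
  assumes "is_successor_on A s" "(x, y) \<in> s" "(x, z) \<in> s"
  shows "y = z"
proof -
  obtain r where r: "r \<subseteq> A \<times> A" "strict_linear_order_on A r" "s = successor_rel r"
    using assms(1) by (auto simp: is_successor_on_def)
  have xy: "(x, y) \<in> r" "(x, z) \<in> r" "(y, z) \<notin> r" "(z, y) \<notin> r"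
    using assms(2,3) unfolding r(3) successor_rel_iff by blast+
  then have "y \<in> A" "z \<in> A"
    using r(1) by auto
  then show ?thesis
    using xy(3,4) r(2) unfolding strict_linear_order_on_def total_on_def by metis
qed

lemma is_successor_on_wf:
  assumes "is_successor_on A s" "finite A"
  shows "wf (s\<inverse>)"
proof -
  obtain r where r: "r \<subseteq> A \<times> A" "strict_linear_order_on A r" "s = successor_rel r"
    using assms(1) by (auto simp: is_successor_on_def)
  have "acyclic r"
    using r(2) by (simp add: strict_linear_order_on_def acyclic_irrefl trancl_id)
  then have "wf (r\<inverse>)"
    using r(1) assms(2) by (intro finite_acyclic_wf_converse) (auto intro: finite_subset)
  then show ?thesis
    by (rule wf_subset) (auto simp: r(3) successor_rel_def)
qed

lemma sat_row_fo:
  assumes M: "finite_structure M"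
  shows "sat M \<sigma> (row_fo N) \<longleftrightarrow>
    (\<forall>x \<in> carrier M. x \<notin> unary M rgt \<longrightarrow> (\<exists>y. (x, y) \<in> succ1 M)) \<and>
    (\<forall>r < N. unary M rgt \<inter> unary M (reg r) = {}) \<and>
    (\<forall>r < N. \<forall>x y. (x, y) \<in> succ1 M \<longrightarrow> x \<notin> unary M rgt \<longrightarrow> y \<in> unary M (reg r) \<longrightarrow> x \<in> unary M (reg r)) \<and>
    (\<forall>q < N. \<forall>x y. (x, y) \<in> succ1 M \<longrightarrow> x \<notin> unary M rgt \<longrightarrow> x \<in> unary M (st q) \<longrightarrow> y \<in> unary M (st q))"
proof -
  have "\<exists>x. x \<in> carrier M"
    using finite_structure_subsets(1)[OF M] by blast
  then show ?thesis
    using finite_structure_subsets[OF M]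
    by (simp add: row_fo_def ball_Un atLeast0LessThan; intro conj_cong refl; blast)
qed

lemma sat_oper_fo:
  assumes M: "finite_structure M"
  shows "sat M \<sigma> (oper_fo q r p i) \<longleftrightarrow> (case p of
      Zero \<Rightarrow> \<forall>x y. (x, y) \<in> succ2 M \<longrightarrow> x \<in> unary M (st q) \<longrightarrow> y \<notin> unary M (reg r)
    | Keep \<Rightarrow> \<forall>x y. (x, y) \<in> succ2 M \<longrightarrow> x \<in> unary M (st q) \<longrightarrow>
        (y \<in> unary M (reg r) \<longleftrightarrow> x \<in> unary M (reg i))
    | Inc \<Rightarrow>
        (\<forall>x y. (x, y) \<in> succ2 M \<longrightarrow> x \<in> unary M (st q) \<longrightarrow> x \<in> unary M lft \<longrightarrow> y \<in> unary M (reg r)) \<and>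
        (\<forall>x x' y'. (x, x') \<in> succ1 M \<longrightarrow> (x', y') \<in> succ2 M \<longrightarrow> x \<in> unary M (st q) \<longrightarrow> x \<notin> unary M rgt \<longrightarrow>
          (y' \<in> unary M (reg r) \<longleftrightarrow> x \<in> unary M (reg i)))
    | Dec \<Rightarrow> \<forall>x x' y. (x, x') \<in> succ1 M \<longrightarrow> (x, y) \<in> succ2 M \<longrightarrow> x \<in> unary M (st q) \<longrightarrow> x \<notin> unary M rgt \<longrightarrow>
          (y \<in> unary M (reg r) \<longleftrightarrow> x' \<in> unary M (reg i)))"
  using finite_structure_subsets[OF M] by (cases p; simp; blast)

lemma sat_instr_fo:
  assumes M: "finite_structure M"
  shows "sat M \<sigma> (instr_fo N q (Ins j p i b t1 t2)) \<longleftrightarrow>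
    (\<forall>x \<in> unary M (st q). \<exists>y. (x, y) \<in> succ2 M) \<and>
    (\<forall>x x' y y'. x \<in> unary M (st q) \<longrightarrow> x \<notin> unary M rgt \<longrightarrow> (x, x') \<in> succ1 M \<longrightarrow>
      (x, y) \<in> succ2 M \<longrightarrow> (x', y') \<in> succ2 M \<longrightarrow> (y, y') \<in> succ1 M) \<and>
    (\<forall>x y. x \<in> unary M (st q) \<longrightarrow> (x, y) \<in> succ2 M \<longrightarrow>
      (y \<in> unary M lft \<longleftrightarrow> x \<in> unary M lft) \<and> (y \<in> unary M rgt \<longleftrightarrow> x \<in> unary M rgt)) \<and>
    (\<forall>x y. x \<in> unary M (st q) \<longrightarrow> (x, y) \<in> succ2 M \<longrightarrow> x \<in> unary M lft \<longrightarrow>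
      x \<in> unary M (reg b) \<longrightarrow> y \<in> unary M (st t1)) \<and>
    (\<forall>x y. x \<in> unary M (st q) \<longrightarrow> (x, y) \<in> succ2 M \<longrightarrow> x \<in> unary M lft \<longrightarrow>
      x \<notin> unary M (reg b) \<longrightarrow> y \<in> unary M (st t2)) \<and>
    (\<forall>r < N. sat M \<sigma> (oper_fo q r (if r = j then p else Keep) (if r = j then i else r)))"
proof -
  have "\<exists>x. x \<in> carrier M"
    using finite_structure_subsets(1)[OF M] by blast
  then show ?thesis
    using finite_structure_subsets[OF M]
    by (simp add: ball_Un atLeast0LessThan del: oper_fo.simps split del: if_split;
        intro conj_cong refl; blast)
qed

section \<open>Models encode computations\<close>

definition config_row :: "'a struct \<Rightarrow> nat \<Rightarrow> nat \<times> (nat \<Rightarrow> nat) \<Rightarrow> bool" where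
  "config_row M N = (\<lambda>(q, s). \<exists>p W.
     (\<forall>i \<le> W. p i \<in> carrier M \<and> p i \<in> unary M (st q) \<and> (p i \<in> unary M rgt \<longleftrightarrow> i = W)
        \<and> (\<forall>r < N. p i \<in> unary M (reg r) \<longleftrightarrow> i < s r)) \<and>
     (\<forall>i < W. (p i, p (Suc i)) \<in> succ1 M) \<and> p 0 \<in> unary M lft)"


lemma row_path:
  assumes M: "finite_structure M" and row: "sat M \<sigma> (row_fo N)" and x: "x \<in> carrier M"
  shows "\<exists>p W. p 0 = x \<and> (\<forall>i \<le> W. p i \<in> carrier M \<and> (p i \<in> unary M rgt \<longleftrightarrow> i = W)) \<and>
    (\<forall>i < W. (p i, p (Suc i)) \<in> succ1 M)"
proof -
  have "wf ((succ1 M)\<inverse>)"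
    using M is_successor_on_wf unfolding finite_structure_def by blast
  then show ?thesis
    using x
  proof (induction x rule: wf_induct_rule)
    case (less x)
    show ?case
    proof (cases "x \<in> unary M rgt")
      case True
      then show ?thesis
        using less.prems by (intro exI[of _ "\<lambda>_. x"] exI[of _ 0]) auto
    next
      case False
      then obtain y where y: "(x, y) \<in> succ1 M"
        using row less.prems unfolding sat_row_fo[OF M] by blast
      then have "y \<in> carrier M"
        using finite_structure_subsets(3)[OF M] by blast
      then obtain p W where "p 0 = y" "\<forall>i \<le> W. p i \<in> carrier M \<and> (p i \<in> unary M rgt \<longleftrightarrow> i = W)"
        "\<forall>i < W. (p i, p (Suc i)) \<in> succ1 M"
        using less.IH[of y] y by auto
      then show ?thesis
        using False y less.prems
        by (intro exI[of _ "\<lambda>i. case i of 0 \<Rightarrow> x | Suc i \<Rightarrow> p i"] exI[of _ "Suc W"])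
          (auto split: nat.splits)
    qed
  qed
qed

lemma sat_segment_fo:
  assumes M: "finite_structure M" and row: "sat M \<sigma>' (row_fo N)" and N: "0 < N"
    and p: "\<And>i. i \<le> W \<Longrightarrow> p i \<in> unary M rgt \<longleftrightarrow> i = W" "\<And>i. i < W \<Longrightarrow> (p i, p (Suc i)) \<in> succ1 M"
    and "sat M \<sigma> (segment_fo n)" "\<sigma> 0 = p k" "k \<le> W"
  shows "k + n \<le> W \<and> (\<forall>i < n. p (k + i) \<in> unary M (reg 0)) \<and> p (k + n) \<notin> unary M (reg 0)"
  using assms(6-8)
proof (induction n arbitrary: k \<sigma>)
  case 0
  then show ?case by simp
next
  case (Suc n)
  obtain y where y: "p k \<in> unary M (reg 0)" "(p k, y) \<in> succ1 M"
    "sat M (\<sigma>(1 := y, 0 := y)) (segment_fo n)"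
    using Suc.prems(1,2) by auto
  have "k \<noteq> W"
    using y(1) p(1)[OF Suc.prems(3)] row N unfolding sat_row_fo[OF M] by blast
  then have k: "k < W" using Suc.prems(3) by simp
  have "is_successor_on (carrier M) (succ1 M)"
    using M unfolding finite_structure_def by blast
  then have "y = p (Suc k)"
    using is_successor_on_functional y(2) p(2)[OF k] by metis
  then have "Suc k + n \<le> W \<and> (\<forall>i < n. p (Suc k + i) \<in> unary M (reg 0)) \<and> p (Suc k + n) \<notin> unary M (reg 0)"
    using k by (intro Suc.IH[OF y(3)]) auto
  then show ?case
    using y(1) by (auto simp: less_Suc_eq_0_disj)
qed

lemma propagate:
  assumes "P 0" "\<And>i. i < W \<Longrightarrow> P i \<Longrightarrow> P (Suc i)" "k \<le> W"
  shows "P k"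
  using assms(3) by (induction k) (auto intro: assms(1,2))

lemma initial_row:
  assumes M: "finite_structure M" and row: "sat M \<sigma> (row_fo N)" and N: "0 < N"
    and input: "sat M \<sigma> (input_fo n)"
  shows "\<exists>s. s 0 = n \<and> config_row M N (0, s)"
proof -
  obtain x where x: "x \<in> carrier M" "x \<in> unary M lft" "x \<in> unary M (st 0)"
    "sat M (\<sigma>(0 := x)) (segment_fo n)"
    using input by (auto simp: input_fo_def)
  obtain p W where p: "p 0 = x" "\<And>i. i \<le> W \<Longrightarrow> p i \<in> carrier M \<and> (p i \<in> unary M rgt \<longleftrightarrow> i = W)"
    "\<And>i. i < W \<Longrightarrow> (p i, p (Suc i)) \<in> succ1 M"
    using row_path[OF M row x(1)] by blast
  have st: "p i \<in> unary M (st 0)" if "i \<le> W" for i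
    using that
  proof (rule propagate[of "\<lambda>i. p i \<in> unary M (st 0)", rotated 2])
    show "p 0 \<in> unary M (st 0)" using x(3) p(1) by simp
    show "p (Suc i) \<in> unary M (st 0)" if "i < W" "p i \<in> unary M (st 0)" for i
      using row p(2)[of i] p(3)[of i] that N unfolding sat_row_fo[OF M] by force
  qed
  define s where "s r = (LEAST i. p i \<notin> unary M (reg r))" for r
  have s: "p i \<in> unary M (reg r) \<longleftrightarrow> i < s r" if "r < N" "i \<le> W" for r i
  proof -
    have "p i \<notin> unary M (reg r)" if "s r \<le> i"
      using that \<open>i \<le> W\<close>
    proof (induction rule: dec_induct)
      case base
      have "p W \<notin> unary M (reg r)"
        using row p(2)[of W] \<open>r < N\<close> unfolding sat_row_fo[OF M] by blast
      then show ?case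
        unfolding s_def by (rule LeastI)
    next
      case (step m)
      then show ?case
        using row p(2)[of m] p(3)[of m] \<open>r < N\<close> unfolding sat_row_fo[OF M] by force
    qed
    moreover have "p i \<in> unary M (reg r)" if "i < s r"
      using not_less_Least that unfolding s_def by blast
    ultimately show ?thesis
      by (meson not_le_imp_less)
  qed
  have "n \<le> W \<and> (\<forall>i < n. p i \<in> unary M (reg 0)) \<and> p n \<notin> unary M (reg 0)"
    using sat_segment_fo[where p = p and W = W and k = 0, OF M row N conjunct2[OF p(2)] p(3) x(4)] p(1)
    by simp
  then have "s 0 = n"
    using s[OF N] by (metis less_imp_le_nat linorder_neqE_nat order_less_irrefl order_trans)
  moreover have "config_row M N (0, s)"
    unfolding config_row_def prod.case using p st s x(2)
    by (intro exI[of _ p] exI[of _ W]) simp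
  ultimately show ?thesis by blast
qed

lemma step_row:
  assumes M: "finite_structure M" and row: "sat M \<sigma> (row_fo N)"
    and instr: "sat M \<sigma> (instr_fo N q (Ins j p i b t1 t2))" and bound: "i < N" "b < N" "t1 < N" "t2 < N"
    and conf: "config_row M N (q, s)"
  shows "config_row M N (if s b \<noteq> 0 then t1 else t2, s(j := app p (s i)))"
proof -
  obtain c W where c: "\<And>k. k \<le> W \<Longrightarrow> c k \<in> unary M (st q)"
    "\<And>k. k \<le> W \<Longrightarrow> c k \<in> unary M rgt \<longleftrightarrow> k = W"
    "\<And>k r. k \<le> W \<Longrightarrow> r < N \<Longrightarrow> c k \<in> unary M (reg r) \<longleftrightarrow> k < s r"
    "\<And>k. k < W \<Longrightarrow> (c k, c (Suc k)) \<in> succ1 M" "c 0 \<in> unary M lft"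
    using conf unfolding config_row_def by auto
  note instr = instr[unfolded sat_instr_fo[OF M]]
  have down: "\<exists>y. (x, y) \<in> succ2 M" if "x \<in> unary M (st q)" for x
    using conjunct1[OF instr] that by simp
  note instr = conjunct2[OF instr]
  have square: "(y, y') \<in> succ1 M" if "x \<in> unary M (st q)" "x \<notin> unary M rgt" "(x, x') \<in> succ1 M"
    "(x, y) \<in> succ2 M" "(x', y') \<in> succ2 M" for x x' y y'
    using conjunct1[OF instr] that by simp
  note instr = conjunct2[OF instr]
  have border: "y \<in> unary M lft \<longleftrightarrow> x \<in> unary M lft" "y \<in> unary M rgt \<longleftrightarrow> x \<in> unary M rgt"
    if "x \<in> unary M (st q)" "(x, y) \<in> succ2 M" for x y
    using conjunct1[OF instr] that by simp_all
  note instr = conjunct2[OF instr]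
  have jump1: "y \<in> unary M (st t1)"
    if "x \<in> unary M (st q)" "(x, y) \<in> succ2 M" "x \<in> unary M lft" "x \<in> unary M (reg b)" for x y
    using conjunct1[OF instr] that by simp
  note instr = conjunct2[OF instr]
  have jump2: "y \<in> unary M (st t2)"
    if "x \<in> unary M (st q)" "(x, y) \<in> succ2 M" "x \<in> unary M lft" "x \<notin> unary M (reg b)" for x y
    using conjunct1[OF instr] that by simp
  note opers = conjunct2[OF instr]
  have rgt_reg: "x \<notin> unary M (reg r)" if "x \<in> unary M rgt" "r < N" for x r
    using row that unfolding sat_row_fo[OF M] by blast
  have spread: "y \<in> unary M (st a)"
    if "x \<in> unary M (st a)" "(x, y) \<in> succ1 M" "x \<notin> unary M rgt" "a < N" for x y a
    using row that unfolding sat_row_fo[OF M] by blast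
  have "\<forall>k. \<exists>y. k \<le> W \<longrightarrow> (c k, y) \<in> succ2 M"
    using down c(1) by blast
  then obtain d where d: "\<And>k. k \<le> W \<Longrightarrow> (c k, d k) \<in> succ2 M"
    by metis
  have d_succ: "(d k, d (Suc k)) \<in> succ1 M" if "k < W" for k
    by (rule square[of "c k" "c (Suc k)"]) (use c d that in auto)
  have d_rgt: "d k \<in> unary M rgt \<longleftrightarrow> k = W" if "k \<le> W" for k
    using border(2)[OF c(1) d] c(2) that by simp
  have d_lft: "d 0 \<in> unary M lft"
    using border(1)[OF c(1) d, of 0] c(5) by simp
  let ?q = "if s b \<noteq> 0 then t1 else t2"
  have d0: "d 0 \<in> unary M (st ?q)"
  proof (cases "s b \<noteq> 0")
    case True
    then have "c 0 \<in> unary M (reg b)"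
      using c(3)[of 0 b] bound by simp
    then have "d 0 \<in> unary M (st t1)"
      by (rule jump1[OF c(1) d c(5), rotated 2]) simp_all
    then show ?thesis using True by simp
  next
    case False
    then have "c 0 \<notin> unary M (reg b)"
      using c(3)[of 0 b] bound by simp
    then have "d 0 \<in> unary M (st t2)"
      by (rule jump2[OF c(1) d c(5), rotated 2]) simp_all
    then show ?thesis using False by simp
  qed
  have q: "?q < N"
    using bound by simp
  have d_st: "d k \<in> unary M (st ?q)" if "k \<le> W" for k
    using that
  proof (rule propagate[of "\<lambda>k. d k \<in> unary M (st ?q)", rotated 2])
    show "d 0 \<in> unary M (st ?q)" by (rule d0)
    show "d (Suc k) \<in> unary M (st ?q)" if "k < W" "d k \<in> unary M (st ?q)" for k
    proof -
      have "d k \<notin> unary M rgt" using d_rgt[of k] that(1) by simp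
      then show ?thesis by (rule spread[OF that(2) d_succ[OF that(1)] _ q])
    qed
  qed
  have oper: "d k \<in> unary M (reg r) \<longleftrightarrow> k < app f (s m)"
    if op: "sat M \<sigma> (oper_fo q r f m)" and k: "k \<le> W" and rm: "r < N" "m < N" for k r f m
  proof (cases f)
    case Zero
    then show ?thesis
      using op c(1)[OF k] d[OF k] unfolding sat_oper_fo[OF M] by auto
  next
    case Keep
    then show ?thesis
      using op c(1,3)[OF k] d[OF k] rm unfolding sat_oper_fo[OF M] by auto
  next
    case Inc
    note op = op[unfolded sat_oper_fo[OF M] Inc oper.case]
    show ?thesis
    proof (cases k)
      case 0
      then show ?thesis
        using Inc op c(1)[of 0] c(5) d[of 0] by auto
    next
      case (Suc k')
      have "c k' \<in> unary M (st q)" "c k' \<notin> unary M rgt" "(c k', c k) \<in> succ1 M" "(c k, d k) \<in> succ2 M"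
        "c k' \<in> unary M (reg m) \<longleftrightarrow> k' < s m"
        using c d[OF k] Suc k rm by auto
      then have "d k \<in> unary M (reg r) \<longleftrightarrow> k' < s m"
        using op by blast
      then show ?thesis using Suc Inc by simp
    qed
  next
    case Dec
    note op = op[unfolded sat_oper_fo[OF M] Dec oper.case]
    show ?thesis
    proof (cases "k = W")
      case True
      have "d W \<notin> unary M (reg r)" "c W \<notin> unary M (reg m)"
        using rgt_reg d_rgt[of W] c(2)[of W] rm by blast+
      then show ?thesis
        using True Dec c(3)[of W m] rm by simp
    next
      case False
      then have "c k \<in> unary M (st q)" "c k \<notin> unary M rgt" "(c k, c (Suc k)) \<in> succ1 M" "(c k, d k) \<in> succ2 M"
        "c (Suc k) \<in> unary M (reg m) \<longleftrightarrow> Suc k < s m"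
        using c d[OF k] k rm by auto
      then have "d k \<in> unary M (reg r) \<longleftrightarrow> Suc k < s m"
        using op by blast
      then show ?thesis using Dec by auto
    qed
  qed
  have d_reg: "d k \<in> unary M (reg r) \<longleftrightarrow> k < (s(j := app p (s i))) r" if "k \<le> W" "r < N" for k r
  proof -
    have "sat M \<sigma> (oper_fo q r (if r = j then p else Keep) (if r = j then i else r))"
      using opers that(2) by blast
    then show ?thesis
      using oper[of r p i k] oper[of r Keep r k] that bound(1) by (cases "r = j") auto
  qed
  have "d k \<in> carrier M" if "k \<le> W" for k
    using d[OF that] finite_structure_subsets(4)[OF M] by blast
  then show ?thesis
    unfolding config_row_def prod.case using d_succ d_rgt d_lft d_st d_reg
    by (intro exI[of _ d] exI[of _ W]) simp
qed

lemma reject_unsat: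
  assumes M: "finite_structure M" and prog: "sat M \<sigma> (prog_fo N P)" and input: "sat M \<sigma> (input_fo n)"
    and bound: "prog_bound N P" and run: "\<And>s. s 0 = n \<Longrightarrow> \<exists>t. (mstep P)\<^sup>*\<^sup>* (0, s) (length P, t)"
  shows False
proof -
  have row: "sat M \<sigma> (row_fo N)"
    and "sat M \<sigma> (All (Neg (St (length P) 0)))"
    and instrs: "\<forall>\<phi> \<in> set (map (\<lambda>q. instr_fo N q (P ! q)) [0..<length P]). sat M \<sigma> \<phi>"
    using prog unfolding prog_fo_def Conj_simps(3) list.set(2) ball_simps by blast+
  then have reject: "unary M (st (length P)) = {}"
    using finite_structure_subsets(2)[OF M, of "st (length P)"] by auto
  have instr: "sat M \<sigma> (instr_fo N a (P ! a))" if "a < length P" for a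
    by (rule bspec[OF instrs]) (use that in auto)
  have "0 < N"
    using bound by (simp add: prog_bound_def)
  then obtain s where s: "s 0 = n" "config_row M N (0, s)"
    using initial_row[OF M row _ input] by blast
  obtain t where "(mstep P)\<^sup>*\<^sup>* (0, s) (length P, t)"
    using run[of s, OF s(1)] by blast
  then have "config_row M N (length P, t)"
  proof (induction rule: rtranclp_induct)
    case base
    show ?case by (rule s(2))
  next
    case (step y z)
    from step.hyps(2) show ?case
    proof cases
      case (1 a j p i b t1 t2 s)
      have "instr_bound N (Ins j p i b t1 t2)"
        using bound nth_mem[OF 1(3)] unfolding prog_bound_def 1(4) by blast
      then have b: "i < N" "b < N" "t1 < N" "t2 < N"
        by simp_all
      have "sat M \<sigma> (instr_fo N a (Ins j p i b t1 t2))"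
        using instr[OF 1(3)] unfolding 1(4) .
      from step_row[OF M row this b step.IH[unfolded 1(1)]] show ?thesis
        unfolding 1(2) .
    qed
  qed
  then show False
    using reject by (auto simp: config_row_def)
qed

section \<open>Computations yield models\<close>

lemma is_successor_on_enum:
  fixes f :: "'a \<Rightarrow> nat"
  assumes f: "bij_betw f A {..<m}"
  shows "is_successor_on A {(a, b). a \<in> A \<and> b \<in> A \<and> f b = Suc (f a)}"
proof -
  let ?r = "{(a, b). a \<in> A \<and> b \<in> A \<and> f a < f b}"
  have "total_on A ?r"
    using f unfolding total_on_def bij_betw_def inj_on_def by simp (metis nat_neq_iff)
  moreover have "trans ?r" "irrefl ?r"
    by (auto simp: trans_def irrefl_def)
  moreover have "{(a, b). a \<in> A \<and> b \<in> A \<and> f b = Suc (f a)} = successor_rel ?r"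
  proof -
    have "f b = Suc (f a) \<longleftrightarrow> f a < f b \<and> \<not> (\<exists>c \<in> A. f a < f c \<and> f c < f b)" if "b \<in> A" for a b
    proof
      assume gap: "f a < f b \<and> \<not> (\<exists>c \<in> A. f a < f c \<and> f c < f b)"
      have "f b < m"
        using bij_betwE[OF f] that by auto
      then have "Suc (f a) \<in> f ` A"
        using gap f by (simp add: bij_betw_def)
      then obtain c where "c \<in> A" "f c = Suc (f a)"
        by (metis imageE)
      then show "f b = Suc (f a)"
        using gap by (metis Suc_lessI lessI)
    qed auto
    then show ?thesis
      by (auto simp: successor_rel_def)
  qed
  ultimately show ?thesis
    unfolding is_successor_on_def strict_linear_order_on_def
    by (intro exI[of _ ?r]) auto
qed

lemma bij_betw_grid: "bij_betw (\<lambda>(t, k). t * n + k) ({..<m} \<times> {..<n}) {..<m * n :: nat}"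
proof (rule bij_betw_byWitness[where f' = "\<lambda>x. (x div n, x mod n)"])
  show "(\<lambda>(t, k). t * n + k) ` ({..<m} \<times> {..<n}) \<subseteq> {..<m * n}"
  proof clarsimp
    fix t k assume "t < m" "k < n"
    then have "t * n + k < Suc t * n" by simp
    also have "\<dots> \<le> m * n" using \<open>t < m\<close> by (intro mult_le_mono1) simp
    finally show "t * n + k < m * n" .
  qed
  show "(\<lambda>x. (x div n, x mod n)) ` {..<m * n} \<subseteq> {..<m} \<times> {..<n}"
    by (auto simp: less_mult_imp_div_less intro!: mod_less_divisor gr0I)
qed auto

definition grid :: "nat \<Rightarrow> nat \<Rightarrow> (nat \<Rightarrow> nat) \<Rightarrow> (nat \<Rightarrow> nat \<Rightarrow> nat) \<Rightarrow> (nat \<times> nat) struct" where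
  "grid m n Q S =
     \<lparr>carrier = {..<m} \<times> {..<n},
      unary = (\<lambda>p. {(t, k). t < m \<and> k < n \<and>
        (p = lft \<and> k = 0 \<or> p = rgt \<and> Suc k = n \<or> (\<exists>r. p = reg r \<and> k < S t r) \<or> p = st (Q t))}),
      succ1 = {(a, b). a \<in> {..<m} \<times> {..<n} \<and> b \<in> {..<m} \<times> {..<n} \<and>
        (case b of (t, k) \<Rightarrow> t * n + k) = Suc (case a of (t, k) \<Rightarrow> t * n + k)},
      succ2 = {(a, b). a \<in> {..<m} \<times> {..<n} \<and> b \<in> {..<m} \<times> {..<n} \<and>
        (case b of (t, k) \<Rightarrow> k * m + t) = Suc (case a of (t, k) \<Rightarrow> k * m + t)}\<rparr>"

lemma carrier_grid [simp]: "carrier (grid m n Q S) = {..<m} \<times> {..<n}"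
  by (simp add: grid_def)

lemma unary_grid [simp]:
  "(t, k) \<in> unary (grid m n Q S) lft \<longleftrightarrow> t < m \<and> k < n \<and> k = 0"
  "(t, k) \<in> unary (grid m n Q S) rgt \<longleftrightarrow> t < m \<and> k < n \<and> Suc k = n"
  "(t, k) \<in> unary (grid m n Q S) (reg r) \<longleftrightarrow> t < m \<and> k < n \<and> k < S t r"
  "(t, k) \<in> unary (grid m n Q S) (st q) \<longleftrightarrow> t < m \<and> k < n \<and> Q t = q"
  by (auto simp: grid_def lft_def rgt_def reg_def st_def; presburger)+

lemma grid_index_inj:
  assumes "t * n + k = t' * n + k'" "k < n" "k' < (n :: nat)"
  shows "t = t' \<and> k = k'"
proof -
  have "(t * n + k) div n = t" "(t' * n + k') div n = t'"
    using assms(2,3) by simp_all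
  then have "t = t'" using assms(1) by metis
  then show ?thesis using assms(1) by simp
qed

lemma succ1_grid:
  assumes "Suc k < n"
  shows "((t, k), y) \<in> succ1 (grid m n Q S) \<longleftrightarrow> t < m \<and> y = (t, Suc k)"
  using grid_index_inj[of "fst y" n "snd y" t "Suc k"] assms by (cases y) (auto simp: grid_def)

lemma succ2_grid:
  assumes "Suc t < m"
  shows "((t, k), y) \<in> succ2 (grid m n Q S) \<longleftrightarrow> k < n \<and> y = (Suc t, k)"
  using grid_index_inj[of "snd y" m "fst y" k "Suc t"] assms by (cases y) (auto simp: grid_def)

lemma succ_grid_carrier:
  "(x, y) \<in> succ1 (grid m n Q S) \<Longrightarrow> x \<in> {..<m} \<times> {..<n} \<and> y \<in> {..<m} \<times> {..<n}"
  "(x, y) \<in> succ2 (grid m n Q S) \<Longrightarrow> x \<in> {..<m} \<times> {..<n} \<and> y \<in> {..<m} \<times> {..<n}"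
  by (auto simp: grid_def)

lemma finite_structure_grid:
  assumes "0 < m" "0 < n"
  shows "finite_structure (grid m n Q S)"
proof -
  have "bij_betw (\<lambda>(t, k). k * m + t) ({..<m} \<times> {..<n}) {..<n * m}"
  proof -
    have "bij_betw prod.swap ({..<m} \<times> {..<n}) ({..<n} \<times> {..<m})"
      by (auto simp: bij_betw_def inj_on_def)
    moreover have "(\<lambda>(k, t). k * m + t) \<circ> prod.swap = (\<lambda>(t, k). k * m + t)"
      by auto
    ultimately show ?thesis
      using bij_betw_trans[OF _ bij_betw_grid, of prod.swap "{..<m} \<times> {..<n}" n m] by simp
  qed
  then show ?thesis
    using is_successor_on_enum[OF bij_betw_grid[of n m]] assms
    unfolding finite_structure_def grid_def Let_def
    by (auto intro!: is_successor_on_enum)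
qed

lemma sat_segment_fo_grid:
  assumes "S 0 0 < n" "0 < m" "\<sigma> 0 = (0, k)" "k + i = S 0 0"
  shows "sat (grid m n Q S) \<sigma> (segment_fo i)"
  using assms(3,4)
proof (induction i arbitrary: \<sigma> k)
  case 0
  then show ?case by simp
next
  case (Suc i)
  have k: "Suc k < n" "k < S 0 0"
    using Suc.prems(2) assms(1) by auto
  have "sat (grid m n Q S) (\<sigma>(1 := (0, Suc k), 0 := (0, Suc k))) (segment_fo i)"
    by (rule Suc.IH[of _ "Suc k"]) (use Suc.prems(2) in auto)
  then show ?case
    using k Suc.prems(1) assms(2) succ1_grid[OF k(1), of 0 "(0, Suc k)" m Q S]
    by (auto intro!: bexI[of _ "(0, Suc k)"])
qed

lemma mstep_lessD: "mstep P (a, s) c \<Longrightarrow> a < length P"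
  by (auto elim: mstep.cases)

lemma mstep_InsD:
  assumes "mstep P (a, s) (a', s')" "P ! a = Ins j p i b t1 t2"
  shows "a' = (if s b \<noteq> 0 then t1 else t2)" "s' = s(j := app p (s i))"
  using assms by (auto elim: mstep.cases)

locale run =
  fixes N m n :: nat and P :: "instr list" and Q :: "nat \<Rightarrow> nat" and S :: "nat \<Rightarrow> nat \<Rightarrow> nat"
  assumes m: "0 < m"
    and step: "\<And>t. Suc t < m \<Longrightarrow> mstep P (Q t, S t) (Q (Suc t), S (Suc t))"
    and accept: "Q (m - 1) = Suc (length P)"
    and bound: "\<And>t r. t < m \<Longrightarrow> r < N \<Longrightarrow> S t r < n"
    and N: "0 < N"
begin

abbreviation "G \<equiv> grid m n Q S"

lemma finite_structure_G: "finite_structure G"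
  using m bound[OF m N] by (intro finite_structure_grid) auto

lemma succ1_cases:
  assumes "(x, y) \<in> succ1 G" "x \<notin> unary G rgt"
  obtains t k where "x = (t, k)" "y = (t, Suc k)" "t < m" "Suc k < n"
proof -
  obtain t k where x: "x = (t, k)" "t < m" "k < n"
    using succ_grid_carrier(1)[OF assms(1)] by auto
  then have "Suc k < n"
    using assms(2) by auto
  then show thesis
    using that succ1_grid[of k n t y m Q S] assms(1) x by simp
qed

lemma before_end:
  assumes "t < m" "Q t < length P"
  shows "Suc t < m"
proof (rule ccontr)
  assume "\<not> Suc t < m"
  then have "t = m - 1" using assms(1) by simp
  then show False using accept assms(2) by simp
qed

lemma succ2_cases:
  assumes "(x, y) \<in> succ2 G" "x \<in> unary G (st q)" "q < length P"
  obtains t k where "x = (t, k)" "y = (Suc t, k)" "Suc t < m" "k < n" "Q t = q"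
proof -
  obtain t k where x: "x = (t, k)" "t < m" "k < n" "Q t = q"
    using assms(2) by (cases x) auto
  then have "Suc t < m"
    using before_end assms(3) by simp
  then show thesis
    using that succ2_grid[of t m k y n Q S] assms(1) x by simp
qed

lemma sat_row: "sat G \<sigma> (row_fo N)"
  unfolding sat_row_fo[OF finite_structure_G]
proof (intro conjI allI impI ballI)
  fix x assume "x \<in> carrier G" "x \<notin> unary G rgt"
  then obtain t k where "x = (t, k)" "t < m" "Suc k < n"
    by (cases x) auto
  then show "\<exists>y. (x, y) \<in> succ1 G"
    using succ1_grid[of k n t _ m Q S] by simp
next
  fix r assume "r < N"
  then show "unary G rgt \<inter> unary G (reg r) = {}"
    using bound by fastforce
qed (auto elim: succ1_cases)

lemma sat_no_reject: "sat G \<sigma> (All (Neg (St (length P) 0)))"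
proof -
  have "Q t \<noteq> length P" if "t < m" for t
  proof (cases "Suc t < m")
    case True
    then show ?thesis using mstep_lessD[OF step] by fastforce
  next
    case False
    then have "t = m - 1" using that by simp
    then show ?thesis using accept by simp
  qed
  then show ?thesis by auto
qed

lemma sat_oper:
  assumes q: "q < length P" and val: "\<And>t. Suc t < m \<Longrightarrow> Q t = q \<Longrightarrow> S (Suc t) r = app p (S t i)"
  shows "sat G \<sigma> (oper_fo q r p i)"
proof (cases p)
  case Zero
  have "y \<notin> unary G (reg r)" if *: "(x, y) \<in> succ2 G" "x \<in> unary G (st q)" for x y
  proof -
    obtain t k where x: "x = (t, k)" "y = (Suc t, k)" "Suc t < m" "k < n" "Q t = q"
      using succ2_cases[OF * q] .
    then show ?thesis using val[OF x(3,5)] Zero by simp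
  qed
  then show ?thesis
    unfolding sat_oper_fo[OF finite_structure_G] Zero oper.case by blast
next
  case Keep
  have "y \<in> unary G (reg r) \<longleftrightarrow> x \<in> unary G (reg i)"
    if *: "(x, y) \<in> succ2 G" "x \<in> unary G (st q)" for x y
  proof -
    obtain t k where x: "x = (t, k)" "y = (Suc t, k)" "Suc t < m" "k < n" "Q t = q"
      using succ2_cases[OF * q] .
    then show ?thesis using val[OF x(3,5)] Keep by simp
  qed
  then show ?thesis
    unfolding sat_oper_fo[OF finite_structure_G] Keep oper.case by blast
next
  case Inc
  have "y \<in> unary G (reg r)" if *: "(x, y) \<in> succ2 G" "x \<in> unary G (st q)" "x \<in> unary G lft" for x y
  proof -
    obtain t k where x: "x = (t, k)" "y = (Suc t, k)" "Suc t < m" "k < n" "Q t = q"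
      using succ2_cases[OF *(1,2) q] .
    then show ?thesis using val[OF x(3,5)] *(3) Inc by simp
  qed
  moreover have "y' \<in> unary G (reg r) \<longleftrightarrow> x \<in> unary G (reg i)"
    if *: "(x, x') \<in> succ1 G" "(x', y') \<in> succ2 G" "x \<in> unary G (st q)" "x \<notin> unary G rgt" for x x' y'
  proof -
    obtain t k where x: "x = (t, k)" "x' = (t, Suc k)" "t < m" "Suc k < n"
      using succ1_cases[OF *(1,4)] .
    then have "x' \<in> unary G (st q)" and Q: "Q t = q"
      using *(3) by auto
    then have y: "y' = (Suc t, Suc k)" "Suc t < m"
      using succ2_cases[OF *(2) _ q] x(2) by auto
    then show ?thesis
      using x val[OF y(2) Q] Inc by simp
  qed
  ultimately show ?thesis
    unfolding sat_oper_fo[OF finite_structure_G] Inc oper.case by blast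
next
  case Dec
  have "y \<in> unary G (reg r) \<longleftrightarrow> x' \<in> unary G (reg i)"
    if *: "(x, x') \<in> succ1 G" "(x, y) \<in> succ2 G" "x \<in> unary G (st q)" "x \<notin> unary G rgt" for x x' y
  proof -
    obtain t k where x: "x = (t, k)" "x' = (t, Suc k)" "t < m" "Suc k < n"
      using succ1_cases[OF *(1,4)] .
    then have y: "y = (Suc t, k)" "Suc t < m" "Q t = q"
      using succ2_cases[OF *(2,3) q] by auto
    then show ?thesis
      using x val[OF y(2,3)] Dec by auto
  qed
  then show ?thesis
    unfolding sat_oper_fo[OF finite_structure_G] Dec oper.case by blast
qed

lemma sat_instr:
  assumes q: "q < length P"
  shows "sat G \<sigma> (instr_fo N q (P ! q))"
proof (cases "P ! q")
  case (Ins j p i b t1 t2)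
  have next_Q: "Q (Suc t) = (if S t b \<noteq> 0 then t1 else t2)" and next_S: "S (Suc t) = (S t)(j := app p (S t i))"
    if "Suc t < m" "Q t = q" for t
    using mstep_InsD[OF step[OF that(1)]] Ins that(2) by blast+
  show ?thesis
    unfolding Ins sat_instr_fo[OF finite_structure_G]
  proof (intro conjI allI impI ballI)
    fix x assume "x \<in> unary G (st q)"
    then obtain t k where x: "x = (t, k)" "t < m" "k < n" "Q t = q"
      by (cases x) auto
    then have "Suc t < m"
      using before_end q by simp
    then show "\<exists>y. (x, y) \<in> succ2 G"
      using x succ2_grid[of t m k _ n Q S] by simp
  next
    fix x x' y y'
    assume *: "x \<in> unary G (st q)" "x \<notin> unary G rgt" "(x, x') \<in> succ1 G" "(x, y) \<in> succ2 G" "(x', y') \<in> succ2 G"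
    obtain t k where x: "x = (t, k)" "x' = (t, Suc k)" "t < m" "Suc k < n"
      using succ1_cases[OF *(3,2)] .
    then have "x' \<in> unary G (st q)"
      using *(1) by auto
    then have "y' = (Suc t, Suc k)" "y = (Suc t, k)" "Suc t < m"
      using succ2_cases[OF *(5) _ q] succ2_cases[OF *(4,1) q] x(1,2) by auto
    then show "(y, y') \<in> succ1 G"
      using x(4) succ1_grid[of k n "Suc t" _ m Q S] by simp
  next
    fix r assume "r < N"
    show "sat G \<sigma> (oper_fo q r (if r = j then p else Keep) (if r = j then i else r))"
      by (rule sat_oper[OF q]) (simp add: next_S)
  qed (auto elim!: succ2_cases[OF _ _ q] simp: next_Q)
qed

lemma sat_prog: "sat G \<sigma> (prog_fo N P)"
  unfolding prog_fo_def Conj_simps(3)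
proof
  fix \<phi>
  assume "\<phi> \<in> set (row_fo N # All (Neg (St (length P) 0)) # map (\<lambda>q. instr_fo N q (P ! q)) [0..<length P])"
  then consider "\<phi> = row_fo N" | "\<phi> = All (Neg (St (length P) 0))"
    | q where "q < length P" "\<phi> = instr_fo N q (P ! q)"
    by auto
  then show "sat G \<sigma> \<phi>"
    by cases (simp_all only: sat_row sat_no_reject sat_instr)
qed

lemma sat_input:
  assumes "Q 0 = 0"
  shows "sat G \<sigma> (input_fo (S 0 0))"
proof -
  have n: "S 0 0 < n"
    using bound[OF m N] .
  have "sat G (\<sigma>(0 := (0, 0))) (segment_fo (S 0 0))"
    by (rule sat_segment_fo_grid[where k = 0]) (use n m in auto)
  then show ?thesis
    using assms n m by (auto simp: input_fo_def)
qed

end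

lemma accept_sat:
  assumes bound: "prog_bound N P" and run: "(mstep P)\<^sup>*\<^sup>* (0, s) (Suc (length P), t)"
  shows "satisfiable (And (prog_fo N P) (input_fo (s 0)))"
proof -
  obtain T where "(mstep P ^^ T) (0, s) (Suc (length P), t)"
    using run by (auto dest: rtranclp_imp_relpowp)
  then obtain c where c: "c 0 = (0, s)" "c T = (Suc (length P), t)" "\<And>i. i < T \<Longrightarrow> mstep P (c i) (c (Suc i))"
    by (auto simp: relpowp_fun_conv)
  define Q S where "Q i = fst (c i)" and "S i = snd (c i)" for i
  have "finite ((\<lambda>(i, r). S i r) ` ({..T} \<times> {..<N}))"
    by simp
  then obtain n where "\<forall>x \<in> (\<lambda>(i, r). S i r) ` ({..T} \<times> {..<N}). x < n"
    unfolding finite_nat_set_iff_bounded by blast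
  then have n: "S i r < n" if "i \<le> T" "r < N" for i r
    using that by auto
  interpret run N "Suc T" n P Q S
  proof
    show "mstep P (Q i, S i) (Q (Suc i), S (Suc i))" if "Suc i < Suc T" for i
      using c(3)[of i] that by (simp add: Q_def S_def)
    show "Q (Suc T - 1) = Suc (length P)"
      using c(2) by (simp add: Q_def)
    show "0 < N"
      using bound by (simp add: prog_bound_def)
  qed (use n in auto)
  have "Q 0 = 0" "S 0 = s"
    using c(1) by (simp_all add: Q_def S_def)
  then have "sat G (\<lambda>_. (0, 0)) (And (prog_fo N P) (input_fo (s 0)))"
    using sat_prog sat_input by (metis And_simps(3))
  then show ?thesis
    using n[of 0 0] N by (intro satisfiableI[OF finite_structure_G, of "\<lambda>_. (0, 0)"]) auto
qed

lemma satisfiable_iff_zero: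
  assumes ev: "rec_eval f [n] y" and bound: "prog_bound N (rec_prog f)"
  shows "satisfiable (And (prog_fo N (rec_prog f)) (input_fo n)) \<longleftrightarrow> y = 0"
proof
  assume "y = 0"
  then obtain t where "(mstep (rec_prog f))\<^sup>*\<^sup>* (0, \<lambda>_. n) (Suc (length (rec_prog f)), t)"
    using rec_prog_run[OF ev, of "\<lambda>_. n"] by auto
  from accept_sat[OF bound this] show "satisfiable (And (prog_fo N (rec_prog f)) (input_fo n))" .
next
  assume "satisfiable (And (prog_fo N (rec_prog f)) (input_fo n))"
  then obtain M :: "nat struct" and \<sigma> where M: "finite_structure M"
    "sat M \<sigma> (prog_fo N (rec_prog f))" "sat M \<sigma> (input_fo n)"
    unfolding satisfiable_def And_simps(3) by blast
  show "y = 0"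
  proof (rule ccontr)
    assume "y \<noteq> 0"
    then have "\<exists>t. (mstep (rec_prog f))\<^sup>*\<^sup>* (0, s) (length (rec_prog f), t)" if "s 0 = n" for s
      using rec_prog_run[of f n y s, OF ev that] by auto
    then show False
      using reject_unsat[OF M bound] by blast
  qed
qed

section \<open>Diagonalisation\<close>

theorem theorem4p11:
  shows "\<not> decidable_problem fo_code F1_sentences satisfiable"
proof
  assume "decidable_problem fo_code F1_sentences satisfiable"
  then obtain f where f: "\<And>\<phi>. \<phi> \<in> F1_sentences \<Longrightarrow> rec_eval f [fo_code \<phi>] (if satisfiable \<phi> then 1 else 0)"
    unfolding decidable_problem_def by blast
  define D where "D k = prod_encode (4, prod_encode (5, prod_encode (k, prod_encode (4, fo_code (input_fo k)))))" for k
  have "computable1 D"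
    unfolding D_def
    by (intro computable1_pair computable1_const computable1_id computable1_input_fo)
  then obtain d where d: "\<And>k. rec_eval d [k] (D k)"
    unfolding computable1_def by blast
  define g where "g = RComp f [d]"
  obtain N where N: "prog_bound N (rec_prog g)"
    using ex_prog_bound by blast
  define k where "k = fo_code (Neg (prog_fo N (rec_prog g)))"
  let ?\<phi> = "And (prog_fo N (rec_prog g)) (input_fo k)"
  have "D k = fo_code ?\<phi>"
    by (simp add: D_def k_def And_def)
  moreover have "?\<phi> \<in> F1_sentences"
    using prog_fo_F1 input_fo_F1 by (simp add: F1_sentences_def)
  ultimately have "rec_eval g [k] (if satisfiable ?\<phi> then 1 else 0)"
    unfolding g_def using rec_eval_comp1[OF d] f by metis
  from satisfiable_iff_zero[OF this N] show False
    by (simp split: if_splits)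
qed

end
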